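(* Let $\theta\in(0,2\pi)$ be an irrational multiple of $\pi$. Then there is a dense subset $D\subseteq\mathfrak{C}_\theta$ such that for every $\xi\in D$ the kernel $\ker\rho_\xi<F_2$ contains a palindromic word of non-torsion-type.
   Context: $F_2=\langle X,Y,Z\mid XYZ=1\rangle$ is the free group on $X,Y$, identified with $\pi_1(M)$ for $M$ a once-punctured torus. For $\theta\in(0,2\pi)$, the Fricke--Klein space $\mathfrak{C}_\theta$ of marked incomplete hyperbolic structures on $M$ with a single cone point of angle $\theta$ at the puncture is identified with $$\mathfrak{C}_\theta=\{(x,y,z)\in(2,\infty)^3\mid x^2+y^2+z^2-xyz-2=-2\cos(\theta/2)\}$$ (with the subspace topology), where $x,y,z$ are the absolute values of the traces of the holonomies of $X,Y,Z$. For $\xi=(x,y,z)\in\mathfrak{C}_\theta$ the holonomy map $\rho_\xi\colon F_2\to\mathrm{PSL}(2,\mathbb{R})$ is well defined up to conjugation; up to conjugation by an isometry of $\mathbb{H}^2$ it is the projection to $\mathrm{PSL}(2,\mathbb{R})$ of the representation $\tilde\rho_\xi\colon F_2\to \mathrm{SL}(2,\mathbb{R})$ given by $$\tilde\rho_\xi(X)=\begin{pmatrix}x&-1\\1&0\end{pmatrix},\quad \tilde\rho_\xi(Y)=\begin{pmatrix}0&\zeta^{-1}\\-\zeta&y\end{pmatrix},\quad \zeta\ge1,\ \zeta+\zeta^{-1}=z,$$ for which $\mathrm{tr}\,\tilde\rho_\xi(X)=x$, $\mathrm{tr}\,\tilde\rho_\xi(Y)=y$, $\mathrm{tr}\,\tilde\rho_\xi(Z)=z$.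 A word $u\in F_2$ is of torsion-type if $u\in\bigcup_{m\ge2}\bigcup_{r\in F_2\setminus\{1\}}\langle\!\langle r^m\rangle\!\rangle$, where $\langle\!\langle\cdot\rangle\!\rangle$ denotes normal closure in $F_2$; it is of non-torsion-type if it is not of torsion-type. A word $w$ is palindromic in $\{X,Y\}$ if, written as a word in $X^{\pm1},Y^{\pm1}$, it reads the same forward and backward, i.e. $w(X,Y)^{-1}=w(X^{-1},Y^{-1})$; similarly for $\{Y,Z\}$ and $\{Z,X\}$. An element of $F_2$ is palindromic if it can be expressed as a word palindromic in $\{X,Y\}$, $\{Y,Z\}$ or $\{Z,X\}$. *)

theory Defs
  imports "HOL-Analysis.Analysis" "HOL-Algebra.Coset"
begin

section \<open>Free groups\<close>

text \<open>
  The letter \<open>(a, True)\<close> stands for the generator \<open>a\<close>, and \<open>(a, False)\<close> for its inverse.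
\<close>

type_synonym 'a letter = "'a \<times> bool"

definition inv_letter :: "'a letter \<Rightarrow> 'a letter" where
  "inv_letter l = (fst l, \<not> snd l)"

definition reduced :: "'a letter list \<Rightarrow> bool" where
  "reduced w \<longleftrightarrow> successively (\<lambda>k l. l \<noteq> inv_letter k) w"

fun reduce_Cons :: "'a letter \<Rightarrow> 'a letter list \<Rightarrow> 'a letter list" where
  "reduce_Cons k [] = [k]"
| "reduce_Cons k (l # w) = (if l = inv_letter k then w else k # l # w)"

definition free_group :: "'a letter list monoid" where
  "free_group = \<lparr>carrier = {w. reduced w}, mult = foldr reduce_Cons, one = []\<rparr>"

definition word_eval :: "('g, 'm) monoid_scheme \<Rightarrow> ('a \<Rightarrow> 'g) \<Rightarrow> 'a letter list \<Rightarrow> 'g" where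
  "word_eval G f w =
     foldr (\<lambda>(a, s) g. (if s then f a else inv\<^bsub>G\<^esub> (f a)) \<otimes>\<^bsub>G\<^esub> g) w \<one>\<^bsub>G\<^esub>"

lemma inv_letter_invol [simp]: "inv_letter (inv_letter l) = l"
  by (simp add: inv_letter_def)

lemma reduced_Nil [simp]: "reduced []"
  by (simp add: reduced_def)

lemma reduced_Cons_iff: "reduced (k # w) \<longleftrightarrow> reduced w \<and> (w = [] \<or> hd w \<noteq> inv_letter k)"
  by (cases w) (auto simp: reduced_def)

lemma reduced_reduce_Cons: "reduced w \<Longrightarrow> reduced (reduce_Cons k w)"
  by (cases w) (auto simp: reduced_Cons_iff)

lemma reduced_foldr: "reduced w \<Longrightarrow> reduced (foldr reduce_Cons u w)"
  by (induction u) (auto simp: reduced_reduce_Cons)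

lemma reduce_Cons_reduced: "reduced (k # w) \<Longrightarrow> reduce_Cons k w = k # w"
  by (cases w) (auto simp: reduced_Cons_iff)

lemma reduce_Cons_cancel:
  assumes "reduced w"
  shows "reduce_Cons k (reduce_Cons (inv_letter k) w) = w"
proof (cases w)
  case (Cons l v)
  show ?thesis
  proof (cases "l = k")
    case True
    then show ?thesis using assms Cons by (simp add: reduce_Cons_reduced)
  next
    case False
    then show ?thesis using Cons by simp
  qed
qed simp

lemma foldr_reduce_Cons_Nil: "reduced u \<Longrightarrow> foldr reduce_Cons u [] = u"
  by (induction u) (auto simp: reduce_Cons_reduced reduced_Cons_iff)

lemma foldr_reduce_Cons:
  assumes "reduced w"
  shows "foldr reduce_Cons (reduce_Cons k v) w = reduce_Cons k (foldr reduce_Cons v w)"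
proof (cases v)
  case (Cons l t)
  then show ?thesis
    using reduce_Cons_cancel[OF reduced_foldr[OF assms], of k t] by auto
qed simp

lemma foldr_reduce_assoc:
  assumes "reduced w"
  shows "foldr reduce_Cons (foldr reduce_Cons u v) w
       = foldr reduce_Cons u (foldr reduce_Cons v w)"
  by (induction u) (auto simp: foldr_reduce_Cons[OF assms])

lemma foldr_reduce_inverse:
  "reduced w \<Longrightarrow>
   foldr reduce_Cons (map inv_letter (rev u)) (foldr reduce_Cons u w) = w"
proof (induction u)
  case (Cons k u)
  have "reduce_Cons (inv_letter k) (reduce_Cons k v) = v" if "reduced v" for v
    using reduce_Cons_cancel[OF that, of "inv_letter k"] by simp
  then show ?case using Cons by (simp add: reduced_foldr)
qed simp

lemma group_free_group: "group (free_group :: 'a letter list monoid)"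
proof (rule groupI)
  fix u :: "'a letter list"
  assume "u \<in> carrier free_group"
  then have u: "reduced u" by (simp add: free_group_def)
  let ?v = "foldr reduce_Cons (map inv_letter (rev u)) []"
  have "foldr reduce_Cons ?v u = []"
    using foldr_reduce_inverse[of "[]" u] foldr_reduce_assoc[OF u]
    by (simp add: u foldr_reduce_Cons_Nil)
  moreover have "reduced ?v" by (simp add: reduced_foldr)
  ultimately show "\<exists>v\<in>carrier free_group. v \<otimes>\<^bsub>free_group\<^esub> u = \<one>\<^bsub>free_group\<^esub>"
    by (auto simp: free_group_def)
qed (auto simp: free_group_def reduced_foldr foldr_reduce_assoc)

context group
begin

lemma word_eval_Nil [simp]: "word_eval G f [] = \<one>"
  by (simp add: word_eval_def)

lemma word_eval_Cons:
  "word_eval G f (l # w) = (if snd l then f (fst l) else inv (f (fst l))) \<otimes> word_eval G f w"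
  by (simp add: word_eval_def split: prod.split)

lemma word_eval_closed:
  assumes "\<And>a. f a \<in> carrier G"
  shows "word_eval G f w \<in> carrier G"
  by (induction w) (auto simp: word_eval_Cons assms)

lemma word_eval_reduce_Cons:
  assumes "\<And>a. f a \<in> carrier G"
  shows "word_eval G f (reduce_Cons k w) = word_eval G f (k # w)"
proof (cases w)
  case (Cons l v)
  then show ?thesis
    using assms[of "fst k"] word_eval_closed[of f v, OF assms]
    by (auto simp: word_eval_Cons inv_letter_def m_assoc[symmetric])
qed simp

lemma word_eval_hom:
  assumes "\<And>a. f a \<in> carrier G"
  shows "word_eval G f \<in> hom free_group G"
proof (rule homI)
  show "word_eval G f (u \<otimes>\<^bsub>free_group\<^esub> v) = word_eval G f u \<otimes> word_eval G f v" for u v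
    by (induction u)
       (auto simp: free_group_def word_eval_reduce_Cons[OF assms] word_eval_Cons
          word_eval_closed[OF assms] assms m_assoc)
qed (rule word_eval_closed[OF assms])

end

definition normal_closure :: "('g, 'm) monoid_scheme \<Rightarrow> 'g set \<Rightarrow> 'g set" where
  "normal_closure G S = \<Inter> {N. N \<lhd> G \<and> S \<subseteq> N}"


section \<open>The group \<open>F\<^sub>2\<close> and its distinguished words\<close>

datatype F2_gen = GX | GY

type_synonym F2_word = "F2_gen letter list"

abbreviation F2 :: "F2_word monoid" where
  "F2 \<equiv> free_group"

definition X\<^sub>F :: F2_word where "X\<^sub>F = [(GX, True)]"
definition Y\<^sub>F :: F2_word where "Y\<^sub>F = [(GY, True)]"
definition Z\<^sub>F :: F2_word where "Z\<^sub>F = inv\<^bsub>F2\<^esub> (X\<^sub>F \<otimes>\<^bsub>F2\<^esub> Y\<^sub>F)"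

lemma F2_generators_closed: "X\<^sub>F \<in> carrier F2" "Y\<^sub>F \<in> carrier F2" "Z\<^sub>F \<in> carrier F2"
proof -
  show X: "X\<^sub>F \<in> carrier F2" and Y: "Y\<^sub>F \<in> carrier F2"
    by (auto simp: X\<^sub>F_def Y\<^sub>F_def free_group_def reduced_def)
  show "Z\<^sub>F \<in> carrier F2"
    unfolding Z\<^sub>F_def using X Y
    by (intro group.inv_closed monoid.m_closed group.is_monoid group_free_group)
qed

lemma XYZ_eq_one: "X\<^sub>F \<otimes>\<^bsub>F2\<^esub> Y\<^sub>F \<otimes>\<^bsub>F2\<^esub> Z\<^sub>F = \<one>\<^bsub>F2\<^esub>"
  unfolding Z\<^sub>F_def using F2_generators_closed
  by (intro group.r_inv monoid.m_closed group.is_monoid group_free_group)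

definition torsion_type :: "F2_word \<Rightarrow> bool" where
  "torsion_type u \<longleftrightarrow>
     u \<in> (\<Union>m\<in>{2::nat..}. \<Union>r\<in>carrier F2 - {\<one>\<^bsub>F2\<^esub>}. normal_closure F2 {r [^]\<^bsub>F2\<^esub> m})"

text \<open>
  For \<open>palindromic_in\<close>, the elements of \<open>S\<close> serve as letters of formal words, which need not
  be freely reduced (free reduction preserves palindromes).
\<close>

definition palindromic_in :: "F2_word set \<Rightarrow> F2_word \<Rightarrow> bool" where
  "palindromic_in S u \<longleftrightarrow>
     (\<exists>w :: F2_word letter list. fst ` set w \<subseteq> S \<and> rev w = w \<and> u = word_eval F2 id w)"

definition palindromic :: "F2_word \<Rightarrow> bool" where
  "palindromic u \<longleftrightarrow>
     palindromic_in {X\<^sub>F, Y\<^sub>F} u \<or> palindromic_in {Y\<^sub>F, Z\<^sub>F} u \<or> palindromic_in {Z\<^sub>F, X\<^sub>F} u"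


section \<open>\<open>SL(2,\<real>)\<close> and \<open>PSL(2,\<real>)\<close>\<close>

definition SL2R :: "(real^2^2) monoid" where
  "SL2R = \<lparr>carrier = {A. det A = 1}, mult = (**), one = mat 1\<rparr>"

definition PSL2R :: "(real^2^2) set monoid" where
  "PSL2R = SL2R Mod {mat 1, - mat 1}"

definition to_PSL2R :: "real^2^2 \<Rightarrow> (real^2^2) set" where
  "to_PSL2R A = {mat 1, - mat 1} #>\<^bsub>SL2R\<^esub> A"

lemma group_SL2R: "group SL2R"
proof (rule groupI)
  fix A :: "real^2^2"
  assume "A \<in> carrier SL2R"
  then have A: "det A = 1" by (simp add: SL2R_def)
  then obtain B where "B ** A = mat 1"
    by (metis invertible_det_nz invertible_left_inverse zero_neq_one)
  moreover from this A have "det B = 1"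
    by (metis det_I det_mul mult.right_neutral)
  ultimately show "\<exists>B\<in>carrier SL2R. B \<otimes>\<^bsub>SL2R\<^esub> A = \<one>\<^bsub>SL2R\<^esub>"
    by (auto simp: SL2R_def)
qed (auto simp: SL2R_def det_mul matrix_mul_assoc)

lemma neg_mat_mult:
  "(- A) ** B = - (A ** B)" "A ** (- B) = - (A ** B)" for A B :: "real^2^2"
  by (simp_all add: vec_eq_iff matrix_matrix_mult_def sum_negf)

lemma center_normal: "{mat 1, - mat 1} \<lhd> SL2R"
proof -
  interpret group SL2R by (rule group_SL2R)
  have neg_one: "- mat 1 \<in> carrier SL2R"
    by (simp add: SL2R_def det_2 mat_def)
  have neg: "A ** - mat 1 = - A" "- mat 1 ** A = - A" for A :: "real^2^2"
    by (simp_all add: neg_mat_mult)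
  have inv_neg: "inv\<^bsub>SL2R\<^esub> (- mat 1) = - mat 1"
    by (rule inv_equality) (use neg_one in \<open>auto simp: SL2R_def neg\<close>)
  have inv_one: "inv\<^bsub>SL2R\<^esub> (mat 1) = mat 1"
    using inv_one by (simp add: SL2R_def)
  have "subgroup {mat 1, - mat 1} SL2R"
    by (rule subgroupI)
       (use neg_one in \<open>auto simp: inv_neg inv_one, auto simp: SL2R_def neg\<close>)
  moreover have "A \<otimes>\<^bsub>SL2R\<^esub> h \<otimes>\<^bsub>SL2R\<^esub> inv\<^bsub>SL2R\<^esub> A \<in> {mat 1, - mat 1}"
    if A: "A \<in> carrier SL2R" and h: "h \<in> {mat 1, - mat 1}" for A h
  proof -
    have "A ** inv\<^bsub>SL2R\<^esub> A = mat 1"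
      using r_inv[OF A] by (simp add: SL2R_def)
    then show ?thesis using h by (auto simp: SL2R_def neg neg_mat_mult)
  qed
  ultimately show ?thesis by (simp add: normal_inv_iff)
qed

lemma group_PSL2R: "group PSL2R"
  unfolding PSL2R_def by (rule normal.factorgroup_is_group[OF center_normal])

lemma to_PSL2R_hom: "to_PSL2R \<in> hom SL2R PSL2R"
  using normal.r_coset_hom_Mod[OF center_normal]
  unfolding PSL2R_def to_PSL2R_def .


section \<open>Fricke--Klein space and holonomy\<close>

definition fricke_klein :: "real \<Rightarrow> (real \<times> real \<times> real) set" where
  "fricke_klein \<theta> =
     {(x, y, z). x > 2 \<and> y > 2 \<and> z > 2 \<and>
        x\<^sup>2 + y\<^sup>2 + z\<^sup>2 - x * y * z - 2 = - 2 * cos (\<theta> / 2)}"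

definition hol_zeta :: "real \<Rightarrow> real" where
  "hol_zeta z = (THE \<zeta>. \<zeta> \<ge> 1 \<and> \<zeta> + inverse \<zeta> = z)"

lemma hol_zeta_eqI:
  assumes "\<zeta> \<ge> 1" and "\<zeta> + inverse \<zeta> = z"
  shows "hol_zeta z = \<zeta>"
  unfolding hol_zeta_def
proof (rule the_equality)
  fix \<eta> :: real
  assume \<eta>: "\<eta> \<ge> 1 \<and> \<eta> + inverse \<eta> = z"
  have "(\<eta> - \<zeta>) * (\<eta> * \<zeta> - 1) =
      \<zeta> * (\<eta> * \<eta> + 1) - \<eta> * (\<zeta> * \<zeta> + 1)"
    by (simp add: algebra_simps)
  also have "\<eta> * \<eta> + 1 = \<eta> * z" using \<eta> by (auto simp: field_simps)
  also have "\<zeta> * \<zeta> + 1 = \<zeta> * z" using assms by (auto simp: field_simps)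
  also have "\<zeta> * (\<eta> * z) - \<eta> * (\<zeta> * z) = 0" by simp
  finally have "\<eta> = \<zeta> \<or> \<eta> * \<zeta> = 1" by auto
  moreover have "\<eta> * \<zeta> \<ge> \<eta>" "\<eta> * \<zeta> \<ge> \<zeta>"
    using \<eta> assms by (auto simp: mult_le_cancel_left1 mult_le_cancel_right1)
  ultimately show "\<eta> = \<zeta>" using \<eta> assms by linarith
qed (use assms in auto)

lemma hol_zeta:
  assumes "z > 2"
  shows "hol_zeta z = (z + sqrt (z\<^sup>2 - 4)) / 2"
    and "hol_zeta z \<ge> 1" and "hol_zeta z + inverse (hol_zeta z) = z"
proof -
  define s where "s = sqrt (z\<^sup>2 - 4)"
  have "2\<^sup>2 \<le> z\<^sup>2" using assms by (intro power_mono) auto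
  then have s: "s\<^sup>2 = z\<^sup>2 - 4" "s \<ge> 0" by (auto simp: s_def)
  let ?\<zeta> = "(z + s) / 2"
  have one: "?\<zeta> \<ge> 1" using assms s by simp
  have "?\<zeta> * ((z - s) / 2) = 1"
    using s by (simp add: power2_eq_square algebra_simps)
  then have "inverse ?\<zeta> = (z - s) / 2" by (rule inverse_unique)
  then have sum: "?\<zeta> + inverse ?\<zeta> = z" by (simp add: field_simps)
  from hol_zeta_eqI[OF one sum] have eq: "hol_zeta z = ?\<zeta>" .
  show "hol_zeta z = (z + sqrt (z\<^sup>2 - 4)) / 2" using eq by (simp add: s_def)
  show "hol_zeta z \<ge> 1" "hol_zeta z + inverse (hol_zeta z) = z"
    unfolding eq using one sum by auto
qed

fun hol_gen :: "real \<times> real \<times> real \<Rightarrow> F2_gen \<Rightarrow> real^2^2" where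
  "hol_gen (x, y, z) GX = vector [vector [x, - 1], vector [1, 0]]"
| "hol_gen (x, y, z) GY = vector [vector [0, inverse (hol_zeta z)], vector [- hol_zeta z, y]]"

definition hol_lift :: "real \<times> real \<times> real \<Rightarrow> F2_word \<Rightarrow> real^2^2" where
  "hol_lift \<xi> = word_eval SL2R (hol_gen \<xi>)"

text \<open>
  The holonomy is only defined up to conjugation; \<open>holonomy \<xi>\<close> is the representative obtained
  from the explicit lift to \<open>SL(2,\<real>)\<close>.
\<close>

definition holonomy :: "real \<times> real \<times> real \<Rightarrow> F2_word \<Rightarrow> (real^2^2) set" where
  "holonomy \<xi> w = to_PSL2R (hol_lift \<xi> w)"

lemma hol_gen_closed:
  assumes "\<xi> \<in> fricke_klein \<theta>"
  shows "hol_gen \<xi> g \<in> carrier SL2R"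
proof -
  obtain x y z where \<xi>: "\<xi> = (x, y, z)" "z > 2"
    using assms by (auto simp: fricke_klein_def)
  with hol_zeta(2)[of z] show ?thesis
    by (cases g) (auto simp: SL2R_def det_2)
qed

lemma hol_lift_hom: "\<xi> \<in> fricke_klein \<theta> \<Longrightarrow> hol_lift \<xi> \<in> hom F2 SL2R"
  unfolding hol_lift_def
  by (intro group.word_eval_hom group_SL2R hol_gen_closed)

lemma holonomy_hom: "\<xi> \<in> fricke_klein \<theta> \<Longrightarrow> holonomy \<xi> \<in> hom F2 PSL2R"
  using hom_compose[OF hol_lift_hom to_PSL2R_hom]
  by (simp add: holonomy_def[abs_def] comp_def)

lemma trace_hol_lift:
  assumes "(x, y, z) \<in> fricke_klein \<theta>"
  shows "trace (hol_lift (x, y, z) X\<^sub>F) = x"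
    and "trace (hol_lift (x, y, z) Y\<^sub>F) = y"
    and "trace (hol_lift (x, y, z) Z\<^sub>F) = z"
proof -
  let ?\<xi> = "(x, y, z)"
  interpret SL: group SL2R by (rule group_SL2R)
  interpret h: group_hom F2 SL2R "hol_lift ?\<xi>"
    using hol_lift_hom[OF assms] group_free_group group_SL2R
    by (simp add: group_hom_def group_hom_axioms_def)
  have one [simp]: "A ** \<one>\<^bsub>SL2R\<^esub> = A" for A by (simp add: SL2R_def)
  have z: "z > 2" using assms by (simp add: fricke_klein_def)
  have mult: "A \<otimes>\<^bsub>SL2R\<^esub> B = A ** B" for A B by (simp add: SL2R_def)
  have X: "hol_lift ?\<xi> X\<^sub>F = hol_gen ?\<xi> GX" and Y: "hol_lift ?\<xi> Y\<^sub>F = hol_gen ?\<xi> GY"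
    by (simp_all add: hol_lift_def X\<^sub>F_def Y\<^sub>F_def word_eval_def mult del: hol_gen.simps)
  show "trace (hol_lift ?\<xi> X\<^sub>F) = x" "trace (hol_lift ?\<xi> Y\<^sub>F) = y"
    by (simp_all add: X Y trace_def sum_2)
  define \<zeta> where "\<zeta> = hol_zeta z"
  have \<zeta>: "\<zeta> \<ge> 1" "\<zeta> + inverse \<zeta> = z" using hol_zeta[OF z] by (auto simp: \<zeta>_def)
  let ?B = "vector [vector [inverse \<zeta>, y - x * inverse \<zeta>], vector [0, \<zeta>]] :: real^2^2"
  have XY: "hol_lift ?\<xi> (X\<^sub>F \<otimes>\<^bsub>F2\<^esub> Y\<^sub>F) = hol_gen ?\<xi> GX ** hol_gen ?\<xi> GY"
    by (simp add: h.hom_mult F2_generators_closed X Y mult del: hol_gen.simps)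
  have mem: "X\<^sub>F \<otimes>\<^bsub>F2\<^esub> Y\<^sub>F \<in> carrier F2"
    using F2_generators_closed by simp
  have "?B ** hol_lift ?\<xi> (X\<^sub>F \<otimes>\<^bsub>F2\<^esub> Y\<^sub>F) = mat 1"
    unfolding XY using \<zeta>(1)
    by (simp add: \<zeta>_def[symmetric] vec_eq_iff forall_2 matrix_matrix_mult_def sum_2 mat_def
        field_simps)
  then have "inv\<^bsub>SL2R\<^esub> (hol_lift ?\<xi> (X\<^sub>F \<otimes>\<^bsub>F2\<^esub> Y\<^sub>F)) = ?B"
    using mem h.hom_closed[OF mem] \<zeta>(1)
    by (intro SL.inv_equality) (auto simp: SL2R_def det_2)
  then have "hol_lift ?\<xi> Z\<^sub>F = ?B"
    unfolding Z\<^sub>F_def using mem by simp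
  then show "trace (hol_lift ?\<xi> Z\<^sub>F) = z"
    using \<zeta>(2) by (simp add: trace_def sum_2 add.commute)
qed

end

theory Submission
  imports Defs
begin

text \<open>
  Put \<open>\<sigma> = \<theta> / 2\<close>. A point \<open>(x, y, z)\<close> of the Fricke--Klein space is a cone torus glued from two
  congruent hyperbolic triangles with vertices at the cone point and angles \<open>\<alpha> + \<beta> + \<gamma> = \<sigma>\<close>.
  Products of reflections in the sides are rotations by \<open>2\<alpha>\<close>, \<open>2\<beta>\<close>, \<open>2\<gamma>\<close> about the vertices, with
  trivial product. Three conjugates \<open>K\<^sub>1\<close>, \<open>K\<^sub>2\<close>, \<open>K\<^sub>3\<close> of the commutator rotate by \<open>\<theta> = 2\<sigma>\<close> about these
  vertices, so whenever \<open>\<alpha> \<equiv> (n + 1) \<sigma>\<close> and \<open>\<beta> \<equiv> m \<sigma>\<close> modulo \<open>\<pi>\<close>, the word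
  \<open>v = K\<^sub>1\<^sup>n\<^sup>+\<^sup>1 K\<^sub>2\<^sup>m K\<^sub>3\<^sup>-\<^sup>(\<^sup>n\<^sup>+\<^sup>m\<^sup>)\<close> lies in the kernel. As \<open>\<sigma> / \<pi>\<close> is irrational, such angles are dense.
  The hyperelliptic involution \<open>X \<mapsto> X\<inverse>\<close>, \<open>Y \<mapsto> Y\<inverse>\<close> preserves the traces, hence the kernel, so the
  reversed word of \<open>v\<close> and the palindrome \<open>v rev(v)\<close> are in the kernel too. After conjugating \<open>v\<close>
  by a power of \<open>X\<close>, the palindrome maps to the generator of the centre of the nilpotent group
  \<open>\<int>[s]/(s\<^sup>3) \<rtimes> \<langle>1 + s\<rangle>\<close>, and no element of torsion type does.
\<close>

section \<open>Powers of elliptic matrices\<close>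

definition mat2 :: "real \<Rightarrow> real \<Rightarrow> real \<Rightarrow> real \<Rightarrow> real^2^2" where
  "mat2 a b c d = vector [vector [a, b], vector [c, d]]"

lemma mat2_eq_iff: "mat2 a b c d = mat2 a' b' c' d' \<longleftrightarrow> a = a' \<and> b = b' \<and> c = c' \<and> d = d'"
  by (auto simp: mat2_def vec_eq_iff forall_2)

lemma mat2_cases: obtains a b c d where "A = mat2 a b c d"
proof
  show "A = mat2 (A$1$1) (A$1$2) (A$2$1) (A$2$2)"
    by (simp add: mat2_def vec_eq_iff forall_2)
qed

lemma mat2_simps:
  "mat2 a b c d ** mat2 a' b' c' d' = mat2 (a*a' + b*c') (a*b' + b*d') (c*a' + d*c') (c*b' + d*d')"
  "mat2 a b c d + mat2 a' b' c' d' = mat2 (a + a') (b + b') (c + c') (d + d')"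
  "s *\<^sub>R mat2 a b c d = mat2 (s*a) (s*b) (s*c) (s*d)"
  "mat s = mat2 s 0 0 s"
  "- mat2 a b c d = mat2 (-a) (-b) (-c) (-d)"
  "det (mat2 a b c d) = a*d - b*c"
  "trace (mat2 a b c d) = a + d"
  by (simp_all add: mat2_def vec_eq_iff forall_2 matrix_matrix_mult_def sum_2 mat_def det_2 trace_def)

text \<open>
  Up to scalars, the three bracketed matrices are products of the reflections in two sides of the
  triangle, one for each vertex, and the third pair of sides closes up the first two.
\<close>

lemma triangle_relation:
  fixes x y \<zeta> \<eta> :: real
  assumes "\<zeta> * \<eta> = 1"
  defines "z \<equiv> \<zeta> + \<eta>"
    and "A \<equiv> mat2 x (- 1) 1 0" and "A' \<equiv> mat2 0 1 (- 1) x"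
    and "B \<equiv> mat2 0 \<eta> (- \<zeta>) y" and "B' \<equiv> mat2 y (- \<eta>) \<zeta> 0"
  shows "(y *\<^sub>R (A ** B ** A' ** B') + mat (y - x * z)) ** (z *\<^sub>R (B ** A' ** B' ** A) + mat (z - x * y))
      = (x*y*z - y\<^sup>2 - z\<^sup>2) *\<^sub>R (x *\<^sub>R (B' ** A' ** B ** A) + mat (x - y * z))"
    and "(y *\<^sub>R (A' ** B' ** A ** B) + mat (y - x * z)) ** (z *\<^sub>R (B' ** A ** B ** A') + mat (z - x * y))
      = (x*y*z - y\<^sup>2 - z\<^sup>2) *\<^sub>R (x *\<^sub>R (B ** A ** B' ** A') + mat (x - y * z))"
proof -
  have \<zeta>: "\<zeta> \<noteq> 0" using assms(1) by auto
  then have \<eta>: "\<eta> = 1 / \<zeta>" using assms(1) by (simp add: field_simps)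
  note defs = z_def A_def A'_def B_def B'_def mat2_simps mat2_eq_iff \<eta>
  show "(y *\<^sub>R (A ** B ** A' ** B') + mat (y - x * z)) ** (z *\<^sub>R (B ** A' ** B' ** A) + mat (z - x * y))
      = (x*y*z - y\<^sup>2 - z\<^sup>2) *\<^sub>R (x *\<^sub>R (B' ** A' ** B ** A) + mat (x - y * z))"
    unfolding defs using \<zeta> by (simp add: field_simps power2_eq_square)
  show "(y *\<^sub>R (A' ** B' ** A ** B) + mat (y - x * z)) ** (z *\<^sub>R (B' ** A ** B ** A') + mat (z - x * y))
      = (x*y*z - y\<^sup>2 - z\<^sup>2) *\<^sub>R (x *\<^sub>R (B ** A ** B' ** A') + mat (x - y * z))"
    unfolding defs using \<zeta> by (simp add: field_simps power2_eq_square)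
qed

text \<open>The polynomial in the Fricke--Klein equation is the trace of the commutator, so on that
  space the equation prescribes the rotation angle of the commutator. The second identity is the
  analogue for the inverted generators.\<close>

lemma trace_commutator:
  fixes x y \<zeta> \<eta> :: real
  assumes "\<zeta> * \<eta> = 1"
  defines "z \<equiv> \<zeta> + \<eta>"
    and "A \<equiv> mat2 x (- 1) 1 0" and "A' \<equiv> mat2 0 1 (- 1) x"
    and "B \<equiv> mat2 0 \<eta> (- \<zeta>) y" and "B' \<equiv> mat2 y (- \<eta>) \<zeta> 0"
  shows "trace (A ** B ** A' ** B') = x\<^sup>2 + y\<^sup>2 + z\<^sup>2 - x * y * z - 2"
    and "trace (A' ** B' ** A ** B) = x\<^sup>2 + y\<^sup>2 + z\<^sup>2 - x * y * z - 2"
proof -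
  have \<zeta>: "\<zeta> \<noteq> 0" using assms(1) by auto
  then have \<eta>: "\<eta> = 1 / \<zeta>" using assms(1) by (simp add: field_simps)
  note defs = z_def A_def A'_def B_def B'_def mat2_simps \<eta>
  show "trace (A ** B ** A' ** B') = x\<^sup>2 + y\<^sup>2 + z\<^sup>2 - x * y * z - 2"
    "trace (A' ** B' ** A ** B) = x\<^sup>2 + y\<^sup>2 + z\<^sup>2 - x * y * z - 2"
    unfolding defs using \<zeta> by (simp_all add: field_simps power2_eq_square)
qed

section \<open>Powers and products of rotations in SL(2,R)\<close>

lemma trace_mult_commute: "trace (A ** B) = trace (B ** A)" for A B :: "real^2^2"
  by (cases A rule: mat2_cases; cases B rule: mat2_cases) (simp add: mat2_simps algebra_simps)

lemma det_scaleR_2: "det (c *\<^sub>R A) = c\<^sup>2 * det A" for A :: "real^2^2"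
  by (cases A rule: mat2_cases) (simp add: mat2_simps algebra_simps power2_eq_square)

lemma scaleR_mat_mult:
  "(c *\<^sub>R A) ** B = c *\<^sub>R (A ** B)" "A ** (c *\<^sub>R B) = c *\<^sub>R (A ** B)" for A B :: "real^2^2"
  by (simp_all add: scalar_matrix_assoc matrix_scalar_ac)

lemma mat_mult_distrib_right: "(A + B) ** C = A ** C + B ** C" for A B C :: "real^2^2"
  by (simp add: vec_eq_iff matrix_matrix_mult_def sum_2 algebra_simps)

lemma SL2R_simps: "A \<in> carrier SL2R \<longleftrightarrow> det A = 1" "A \<otimes>\<^bsub>SL2R\<^esub> B = A ** B" "\<one>\<^bsub>SL2R\<^esub> = mat 1"
  by (simp_all add: SL2R_def)

lemma inv_SL2R_eq:
  assumes "A \<in> carrier SL2R"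
  shows "inv\<^bsub>SL2R\<^esub> A = mat (trace A) + - A"
proof -
  interpret group SL2R by (rule group_SL2R)
  show ?thesis
    by (rule inv_equality; cases A rule: mat2_cases)
      (use assms in \<open>auto simp: SL2R_simps mat2_simps mat2_eq_iff algebra_simps\<close>)
qed

lemma inv_mat2:
  assumes "a * d - b * c = 1"
  shows "inv\<^bsub>SL2R\<^esub> (mat2 a b c d) = mat2 d (- b) (- c) a"
  using assms by (subst inv_SL2R_eq) (auto simp: SL2R_simps mat2_simps mat2_eq_iff)

text \<open>Cayley--Hamilton gives a two-term recurrence for the powers of \<open>M\<close>, solved
  by Chebyshev polynomials. The sign arises because it is \<open>- M\<close> that has the
  eigenvalues exp(i \<sigma>) and exp(-i \<sigma>).\<close>

lemma rotation_power:
  fixes n :: nat and \<sigma> :: real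
  assumes M: "M \<in> carrier SL2R" and tr: "trace M = - 2 * cos \<sigma>"
  shows "sin \<sigma> *\<^sub>R (M [^]\<^bsub>SL2R\<^esub> n)
       = (- 1) ^ Suc n *\<^sub>R (sin (n * \<sigma>) *\<^sub>R M + mat (sin (n * \<sigma> - \<sigma>)))"
proof (induction n)
  case 0
  show ?case by (cases M rule: mat2_cases) (simp add: SL2R_simps mat2_simps)
next
  case (Suc n)
  have sq: "M ** M = (- 2 * cos \<sigma>) *\<^sub>R M + mat (- 1)"
  proof (cases M rule: mat2_cases)
    case (1 a b c d)
    then have "d = - 2 * cos \<sigma> - a" "a * d - b * c = 1"
      using M tr by (auto simp: SL2R_simps mat2_simps)
    then show ?thesis unfolding 1 mat2_simps mat2_eq_iff by (intro conjI; algebra)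
  qed
  have sin: "sin (real (Suc n) * \<sigma>) = 2 * cos \<sigma> * sin (n * \<sigma>) - sin (n * \<sigma> - \<sigma>)"
    by (simp add: algebra_simps sin_add sin_diff)
  have "sin \<sigma> *\<^sub>R (M [^]\<^bsub>SL2R\<^esub> Suc n) = (sin \<sigma> *\<^sub>R (M [^]\<^bsub>SL2R\<^esub> n)) ** M"
    by (simp add: SL2R_simps scaleR_mat_mult)
  also have "\<dots> = (- 1) ^ Suc n *\<^sub>R (sin (n * \<sigma>) *\<^sub>R (M ** M) + mat (sin (n * \<sigma> - \<sigma>)) ** M)"
    unfolding Suc.IH scaleR_mat_mult mat_mult_distrib_right ..
  also have "\<dots> = (- 1) ^ Suc (Suc n) *\<^sub>R (sin (real (Suc n) * \<sigma>) *\<^sub>R M + mat (sin (real (Suc n) * \<sigma> - \<sigma>)))"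
    unfolding sq
    by (cases M rule: mat2_cases, simp only: mat2_simps mat2_eq_iff sin)
      (simp add: algebra_simps)
  finally show ?case .
qed

text \<open>Let \<open>M\<close> have determinant 1 and trace \<open>- 2 * cos \<sigma>\<close> with
  \<open>sin \<sigma> \<noteq> 0\<close>, and write - M = cos \<sigma> + sin \<sigma> J with J^2 =
  -1. If \<open>sin t \<noteq> 0\<close>, then \<open>M + mat (1 - cot_par \<sigma> t)\<close> is a
  multiple of cos t + sin t J, a rotation by 2t. The offset \<open>1 - cos \<sigma>\<close> makes
  the parameters of the triangle angles equal to xz/y, xy/z and yz/x.\<close>

definition cot_par :: "real \<Rightarrow> real \<Rightarrow> real" where
  "cot_par \<sigma> t = 1 - cos \<sigma> + sin \<sigma> * cot t"

lemma rotation_power_cot_par: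
  fixes n :: nat and \<sigma> :: real
  assumes M: "M \<in> carrier SL2R" and tr: "trace M = - 2 * cos \<sigma>"
    and "sin \<sigma> \<noteq> 0" "sin (n * \<sigma>) \<noteq> 0"
  obtains c where "c \<noteq> 0" "M [^]\<^bsub>SL2R\<^esub> n = c *\<^sub>R (M + mat (1 - cot_par \<sigma> (n * \<sigma>)))"
proof
  define c where "c = (- 1) ^ Suc n * sin (n * \<sigma>) / sin \<sigma>"
  show "c \<noteq> 0" using assms by (simp add: c_def)
  have *: "sin (n * \<sigma> - \<sigma>) = sin (n * \<sigma>) * (1 - cot_par \<sigma> (n * \<sigma>))"
    using assms by (simp add: sin_diff cot_par_def cot_def algebra_simps)
  have "sin \<sigma> *\<^sub>R (M [^]\<^bsub>SL2R\<^esub> n) = sin \<sigma> *\<^sub>R c *\<^sub>R (M + mat (1 - cot_par \<sigma> (n * \<sigma>)))"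
    unfolding rotation_power[OF M tr] c_def * using assms(3)
    by (cases M rule: mat2_cases, simp only: mat2_simps mat2_eq_iff) (simp add: distrib_left right_diff_distrib)
  then show "M [^]\<^bsub>SL2R\<^esub> n = c *\<^sub>R (M + mat (1 - cot_par \<sigma> (n * \<sigma>)))"
    using assms(3) scaleR_cancel_left by blast
qed

text \<open>Each power is a scalar multiple of the corresponding linear factor in
  \<open>rel\<close>, so both sides of the relation match up to a scalar. Determinant one leaves
  only the scalars 1 and -1.\<close>

lemma rotation_product:
  fixes n m l :: nat and \<sigma> :: real
  assumes K: "K1 \<in> carrier SL2R" "K2 \<in> carrier SL2R" "K3 \<in> carrier SL2R"
    and tr: "trace K1 = - 2 * cos \<sigma>" "trace K2 = - 2 * cos \<sigma>" "trace K3 = - 2 * cos \<sigma>"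
    and sin: "sin \<sigma> \<noteq> 0" "sin (n * \<sigma>) \<noteq> 0" "sin (m * \<sigma>) \<noteq> 0" "sin (l * \<sigma>) \<noteq> 0"
    and rel: "(K1 + mat (1 - cot_par \<sigma> (n * \<sigma>))) ** (K2 + mat (1 - cot_par \<sigma> (m * \<sigma>)))
       = \<mu> *\<^sub>R (inv\<^bsub>SL2R\<^esub> K3 + mat (1 - cot_par \<sigma> (- (l * \<sigma>))))"
  shows "K1 [^]\<^bsub>SL2R\<^esub> n \<otimes>\<^bsub>SL2R\<^esub> K2 [^]\<^bsub>SL2R\<^esub> m \<otimes>\<^bsub>SL2R\<^esub> inv\<^bsub>SL2R\<^esub> K3 [^]\<^bsub>SL2R\<^esub> l \<in> {mat 1, - mat 1}"
proof -
  interpret group SL2R by (rule group_SL2R)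
  obtain c1 where c1: "K1 [^]\<^bsub>SL2R\<^esub> n = c1 *\<^sub>R (K1 + mat (1 - cot_par \<sigma> (n * \<sigma>)))"
    using rotation_power_cot_par K tr sin by metis
  obtain c2 where c2: "K2 [^]\<^bsub>SL2R\<^esub> m = c2 *\<^sub>R (K2 + mat (1 - cot_par \<sigma> (m * \<sigma>)))"
    using rotation_power_cot_par K tr sin by metis
  obtain c3 where c3: "c3 \<noteq> 0" "K3 [^]\<^bsub>SL2R\<^esub> l = c3 *\<^sub>R (K3 + mat (1 - cot_par \<sigma> (l * \<sigma>)))"
    using rotation_power_cot_par K tr sin by metis
  \<comment> \<open>Reversing both the rotation and its angle changes the matrix only by a
    sign.\<close>
  have "inv\<^bsub>SL2R\<^esub> K3 + mat (1 - cot_par \<sigma> (- (l * \<sigma>))) = - (K3 + mat (1 - cot_par \<sigma> (l * \<sigma>)))"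
    unfolding inv_SL2R_eq[OF K(3)] tr cot_par_def
    by (cases K3 rule: mat2_cases) (simp add: mat2_simps mat2_eq_iff)
  also have "\<dots> = (- 1 / c3) *\<^sub>R (K3 [^]\<^bsub>SL2R\<^esub> l)"
    using c3 by simp
  finally have "K1 [^]\<^bsub>SL2R\<^esub> n ** K2 [^]\<^bsub>SL2R\<^esub> m = (c1 * c2 * \<mu> * (- 1 / c3)) *\<^sub>R (K3 [^]\<^bsub>SL2R\<^esub> l)"
    unfolding c1 c2 scaleR_mat_mult rel by simp
  then obtain d where d: "K1 [^]\<^bsub>SL2R\<^esub> n ** K2 [^]\<^bsub>SL2R\<^esub> m = d *\<^sub>R (K3 [^]\<^bsub>SL2R\<^esub> l)" by blast
  have det: "det (K1 [^]\<^bsub>SL2R\<^esub> n) = 1" "det (K2 [^]\<^bsub>SL2R\<^esub> m) = 1" "det (K3 [^]\<^bsub>SL2R\<^esub> l) = 1"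
    using K nat_pow_closed by (simp_all add: SL2R_simps)
  have "d\<^sup>2 = 1"
    using arg_cong[OF d, of det] det by (simp add: det_mul det_scaleR_2)
  then have "d = 1 \<or> d = - 1" by (simp add: power2_eq_1_iff)
  moreover have "K1 [^]\<^bsub>SL2R\<^esub> n \<otimes>\<^bsub>SL2R\<^esub> K2 [^]\<^bsub>SL2R\<^esub> m \<otimes>\<^bsub>SL2R\<^esub> inv\<^bsub>SL2R\<^esub> K3 [^]\<^bsub>SL2R\<^esub> l
      = d *\<^sub>R (K3 [^]\<^bsub>SL2R\<^esub> l \<otimes>\<^bsub>SL2R\<^esub> inv\<^bsub>SL2R\<^esub> (K3 [^]\<^bsub>SL2R\<^esub> l))"
    using d K by (simp add: SL2R_simps(2) scaleR_mat_mult nat_pow_inv)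
  moreover have "K3 [^]\<^bsub>SL2R\<^esub> l \<otimes>\<^bsub>SL2R\<^esub> inv\<^bsub>SL2R\<^esub> (K3 [^]\<^bsub>SL2R\<^esub> l) = mat 1"
    using K by (simp add: SL2R_simps(3)[symmetric])
  ultimately show ?thesis by auto
qed

section \<open>Words and normal closures\<close>

definition normal_form :: "'a letter list \<Rightarrow> 'a letter list" where
  "normal_form w = foldr reduce_Cons w []"

lemma normal_form_closed: "normal_form w \<in> carrier free_group"
  by (simp add: normal_form_def free_group_def reduced_foldr)

lemma inv_free_generator: "inv\<^bsub>free_group\<^esub> [(a, s)] = [(a, \<not> s)]"
  by (rule group.inv_equality[OF group_free_group])
    (auto simp: free_group_def reduced_def inv_letter_def)

lemma word_eval_generators:
  "word_eval free_group id (map (\<lambda>(a, s). ([(a, True)], s)) w) = normal_form w"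
proof -
  interpret group "free_group :: 'a letter list monoid" by (rule group_free_group)
  show ?thesis
    by (induction w)
      (auto simp: word_eval_Cons normal_form_def inv_free_generator, auto simp: free_group_def)
qed

lemma palindromic_normal_form:
  assumes "rev w = w"
  shows "palindromic (normal_form w)"
proof -
  let ?w = "map (\<lambda>(a, s). ([(a, True)], s)) w"
  have generator: "[(g, True)] = X\<^sub>F \<or> [(g, True)] = Y\<^sub>F" for g
    by (cases g) (auto simp: X\<^sub>F_def Y\<^sub>F_def)
  have "fst ` set ?w \<subseteq> {X\<^sub>F, Y\<^sub>F}" using generator by force
  moreover have "rev ?w = ?w" using assms by (simp add: rev_map)
  moreover have "normal_form w = word_eval F2 id ?w" by (simp add: word_eval_generators)
  ultimately have "palindromic_in {X\<^sub>F, Y\<^sub>F} (normal_form w)"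
    unfolding palindromic_in_def by blast
  then show ?thesis by (simp add: palindromic_def)
qed

section \<open>Evaluation of words in a group and images of normal closures\<close>

context group
begin

lemma word_eval_normal_form:
  assumes "\<And>a. f a \<in> carrier G"
  shows "word_eval G f (normal_form w) = word_eval G f w"
  using assms
  by (induction w) (auto simp: normal_form_def word_eval_reduce_Cons word_eval_Cons)

lemma word_eval_append:
  assumes "\<And>a. f a \<in> carrier G"
  shows "word_eval G f (u @ v) = word_eval G f u \<otimes> word_eval G f v"
  using assms by (induction u) (auto simp: word_eval_Cons word_eval_closed m_assoc)

lemma word_eval_concat_replicate:
  assumes "\<And>a. f a \<in> carrier G"
  shows "word_eval G f (concat (replicate n u)) = word_eval G f u [^] n"
proof (induction n)
  case (Suc n)
  have "word_eval G f u [^] Suc n = word_eval G f u \<otimes> word_eval G f u [^] n"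
    by (rule nat_pow_Suc2) (rule word_eval_closed[OF assms])
  then show ?case using Suc by (simp add: word_eval_append[OF assms] del: nat_pow_Suc)
qed simp

text \<open>Reversing a word amounts to inverting it and each of its letters. A statement proved for
  arbitrary assignments of the generators thereby also covers reversed words.\<close>

lemma word_eval_rev:
  assumes "\<And>a. f a \<in> carrier G"
  shows "word_eval G f (rev w) = inv (word_eval G (\<lambda>a. inv (f a)) w)"
  using assms by (induction w) (auto simp: word_eval_append word_eval_Cons word_eval_closed inv_mult_group)

text \<open>Modulo \<open>J\<close> the image of \<open>x\<close> is central, so the cyclic subgroup
  it generates is normal. The preimage of that subgroup is a normal subgroup containing
  \<open>x\<close>, hence contains the normal closure.\<close>

lemma normal_closure_central_mod:
  assumes "group F" and h: "h \<in> hom F G" and J: "J \<lhd> G" and x: "x \<in> carrier F"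
    and central: "\<And>g. g \<in> carrier G \<Longrightarrow> g \<otimes> h x \<otimes> inv (h x \<otimes> g) \<in> J"
    and u: "u \<in> normal_closure F {x}"
  obtains i :: int where "h u \<otimes> inv (h x [^] i) \<in> J"
proof -
  interpret F: group F by fact
  interpret J: normal J G by fact
  define Q where "Q = G Mod J"
  interpret Q: group Q unfolding Q_def by (rule J.factorgroup_is_group)
  define \<pi> where "\<pi> = (\<lambda>a. J #> h a)"
  have coset: "(\<lambda>a. J #> a) \<in> hom G Q" unfolding Q_def by (rule J.r_coset_hom_Mod)
  have hc: "h a \<in> carrier G" if "a \<in> carrier F" for a using h that by (auto simp: hom_def)
  have \<pi>: "\<pi> \<in> hom F Q"
    unfolding \<pi>_def using hc hom_mult[OF h] hom_mult[OF coset] hom_in_carrier[OF coset]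
    by (intro homI) simp_all
  interpret \<pi>: group_hom F Q \<pi> by unfold_locales (rule \<pi>)
  interpret c: group_hom G Q "\<lambda>a. J #> a" by unfold_locales (rule coset)
  have eqI: "J #> a = J #> b" if "a \<otimes> inv b \<in> J" "a \<in> carrier G" "b \<in> carrier G" for a b
    using that by (metis J.rcos_module_rev J.subgroup_axioms is_group repr_independence)
  have comm: "\<pi> g \<otimes>\<^bsub>Q\<^esub> \<pi> x = \<pi> x \<otimes>\<^bsub>Q\<^esub> \<pi> g" if "g \<in> carrier F" for g
    using central[OF hc[OF that]] hc[OF that] hc[OF x] 
    by (simp add: \<pi>_def flip: c.hom_mult) (rule eqI, auto)
  define N where "N = {v \<in> carrier F. \<exists>i::int. \<pi> v = \<pi> x [^]\<^bsub>Q\<^esub> i}"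
  have "subgroup N F"
  proof (rule F.subgroupI)
    show "N \<noteq> {}" unfolding N_def by (auto intro!: exI[of _ "\<one>\<^bsub>F\<^esub>"] exI[of _ "0::int"])
    show "inv\<^bsub>F\<^esub> v \<in> N" if "v \<in> N" for v
      using that x by (auto simp: N_def Q.int_pow_neg[symmetric])
    show "v \<otimes>\<^bsub>F\<^esub> w \<in> N" if "v \<in> N" "w \<in> N" for v w
      using that x by (auto simp: N_def Q.int_pow_mult[symmetric])
  qed (auto simp: N_def)
  moreover have "g \<otimes>\<^bsub>F\<^esub> v \<otimes>\<^bsub>F\<^esub> inv\<^bsub>F\<^esub> g \<in> N" if g: "g \<in> carrier F" and "v \<in> N" for g v
  proof -
    obtain i :: int where v: "v \<in> carrier F" "\<pi> v = \<pi> x [^]\<^bsub>Q\<^esub> i" using \<open>v \<in> N\<close> by (auto simp: N_def)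
    \<comment> \<open>Conjugation by \<open>\<pi> g\<close> is an endomorphism of \<open>Q\<close>
      fixing \<open>\<pi> x\<close>, hence also its powers.\<close>
    let ?c = "\<lambda>a. \<pi> g \<otimes>\<^bsub>Q\<^esub> a \<otimes>\<^bsub>Q\<^esub> inv\<^bsub>Q\<^esub> \<pi> g"
    have "?c \<in> hom Q Q"
    proof (rule homI)
      fix a b assume ab: "a \<in> carrier Q" "b \<in> carrier Q"
      then have "inv\<^bsub>Q\<^esub> \<pi> g \<otimes>\<^bsub>Q\<^esub> (\<pi> g \<otimes>\<^bsub>Q\<^esub> (b \<otimes>\<^bsub>Q\<^esub> inv\<^bsub>Q\<^esub> \<pi> g)) = b \<otimes>\<^bsub>Q\<^esub> inv\<^bsub>Q\<^esub> \<pi> g"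
        using g by (simp flip: Q.m_assoc)
      then show "?c (a \<otimes>\<^bsub>Q\<^esub> b) = ?c a \<otimes>\<^bsub>Q\<^esub> ?c b"
        using g ab by (simp add: Q.m_assoc)
    qed (use g in simp)
    then have "?c (\<pi> x [^]\<^bsub>Q\<^esub> i) = ?c (\<pi> x) [^]\<^bsub>Q\<^esub> i"
      using x by (intro hom_int_pow) auto
    also have "?c (\<pi> x) = \<pi> x"
      using comm[OF g] g x by (simp add: Q.m_assoc)
    finally have "\<pi> (g \<otimes>\<^bsub>F\<^esub> v \<otimes>\<^bsub>F\<^esub> inv\<^bsub>F\<^esub> g) = \<pi> v"
      using g v by simp
    with g v show ?thesis by (auto simp: N_def)
  qed
  ultimately have "N \<lhd> F" by (simp add: F.normal_inv_iff)
  moreover have "x \<in> N" using x by (auto simp: N_def intro!: exI[of _ "1::int"])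
  ultimately have "u \<in> N" using u by (auto simp: normal_closure_def)
  then obtain i :: int where uc: "u \<in> carrier F" and i: "\<pi> u = \<pi> x [^]\<^bsub>Q\<^esub> i" by (auto simp: N_def)
  have "J #> h u = J #> (h x [^] i)"
    using i hc[OF x] by (simp add: \<pi>_def c.hom_int_pow)
  then have "h u \<in> J #> (h x [^] i)"
    using hc[OF uc] by (metis J.subgroup_axioms rcos_self)
  then have "h u \<otimes> inv (h x [^] i) \<in> J"
    using J.rcos_module_imp hc x by (meson int_pow_closed is_group)
  then show thesis by (rule that)
qed

end

section \<open>Angle coordinates\<close>

text \<open>With r the parameter of \<gamma>, the relation to be shown reads r (pq - p - q) = pq - 2
  + 2 cos \<sigma>. The two identities evaluate both factors after the denominators of the
  cotangents are cleared.\<close>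

lemma cot_par_sum:
  fixes \<alpha> \<beta> \<sigma> :: real
  assumes "sin \<alpha> \<noteq> 0" "sin \<beta> \<noteq> 0"
  defines "p \<equiv> cot_par \<sigma> \<alpha>" and "q \<equiv> cot_par \<sigma> \<beta>" and "\<gamma> \<equiv> \<sigma> - \<alpha> - \<beta>"
  shows "(p * q - p - q) * (sin \<alpha> * sin \<beta>) = sin \<sigma> * sin \<gamma>"
    and "sin \<gamma> \<noteq> 0 \<Longrightarrow> (p * q - 2 + 2 * cos \<sigma>) * (sin \<alpha> * sin \<beta>) = cot_par \<sigma> \<gamma> * (sin \<sigma> * sin \<gamma>)"
proof -
  let ?sa = "sin \<alpha>" and ?ca = "cos \<alpha>" and ?sb = "sin \<beta>" and ?cb = "cos \<beta>"
    and ?s = "sin \<sigma>" and ?c = "cos \<sigma>"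
  define P where "P = (1 - ?c) * ?sa + ?s * ?ca"
  define Q where "Q = (1 - ?c) * ?sb + ?s * ?cb"
  have P: "p * ?sa = P" and Q: "q * ?sb = Q"
    using assms(1,2) by (simp_all add: p_def q_def cot_par_def cot_def P_def Q_def algebra_simps)
  have \<sigma>: "?s\<^sup>2 + ?c\<^sup>2 = 1" by simp
  have sin_\<gamma>: "sin \<gamma> = ?s * (?ca * ?cb - ?sa * ?sb) - ?c * (?sa * ?cb + ?ca * ?sb)"
    and cos_\<gamma>: "cos \<gamma> = ?c * (?ca * ?cb - ?sa * ?sb) + ?s * (?sa * ?cb + ?ca * ?sb)"
    unfolding \<gamma>_def diff_diff_eq sin_diff cos_diff sin_add cos_add by (simp_all add: algebra_simps)
  have "(p * q - p - q) * (?sa * ?sb) = P * Q - P * ?sb - Q * ?sa"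
    unfolding P[symmetric] Q[symmetric] by (simp add: algebra_simps)
  also have "\<dots> = ?s * sin \<gamma>"
    unfolding P_def Q_def sin_\<gamma> using \<sigma> by algebra
  finally show "(p * q - p - q) * (?sa * ?sb) = ?s * sin \<gamma>" .
  have "(p * q - 2 + 2 * ?c) * (?sa * ?sb) = P * Q - (2 - 2 * ?c) * (?sa * ?sb)"
    unfolding P[symmetric] Q[symmetric] by (simp add: algebra_simps)
  also have "\<dots> = ?s * ((1 - ?c) * sin \<gamma> + ?s * cos \<gamma>)"
    unfolding P_def Q_def sin_\<gamma> cos_\<gamma> using \<sigma> by algebra
  also have "\<dots> = cot_par \<sigma> \<gamma> * (?s * sin \<gamma>)" if "sin \<gamma> \<noteq> 0"
    using that by (simp add: cot_par_def cot_def algebra_simps)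
  finally show "(p * q - 2 + 2 * ?c) * (?sa * ?sb) = cot_par \<sigma> \<gamma> * (?s * sin \<gamma>)" if "sin \<gamma> \<noteq> 0"
    using that by blast
qed

text \<open>For p = xz/y, q = xy/z, r = yz/x one has pq = x^2, qr = y^2, pr = z^2 and pqr = xyz, so
  this is the Fricke--Klein equation. It thus encodes that the three angles sum to \<sigma>.\<close>

lemma cot_par_relation:
  fixes \<alpha> \<beta> \<sigma> :: real
  assumes "sin \<sigma> \<noteq> 0" "sin \<alpha> \<noteq> 0" "sin \<beta> \<noteq> 0" "sin (\<sigma> - \<alpha> - \<beta>) \<noteq> 0"
  defines "p \<equiv> cot_par \<sigma> \<alpha>" and "q \<equiv> cot_par \<sigma> \<beta>" and "r \<equiv> cot_par \<sigma> (\<sigma> - \<alpha> - \<beta>)"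
  shows "p * q + q * r + p * r - p * q * r = 2 - 2 * cos \<sigma>"
proof -
  have "(p * q - 2 + 2 * cos \<sigma>) * (sin \<alpha> * sin \<beta>) = r * ((p * q - p - q) * (sin \<alpha> * sin \<beta>))"
    unfolding p_def q_def r_def using cot_par_sum assms(2-4) by simp
  then have "p * q - 2 + 2 * cos \<sigma> = r * (p * q - p - q)"
    using assms(2,3) by simp
  then show ?thesis by (simp add: algebra_simps)
qed

lemma cot_par_solve:
  fixes p q r \<sigma> :: real
  assumes rel: "p * q + q * r + p * r - p * q * r = 2 - 2 * cos \<sigma>" and "sin \<sigma> \<noteq> 0"
  obtains \<alpha> \<beta> where "sin \<alpha> \<noteq> 0" "sin \<beta> \<noteq> 0" "sin (\<sigma> - \<alpha> - \<beta>) \<noteq> 0"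
    "cot_par \<sigma> \<alpha> = p" "cot_par \<sigma> \<beta> = q" "cot_par \<sigma> (\<sigma> - \<alpha> - \<beta>) = r"
proof -
  \<comment> \<open>An inverse cotangent with values strictly between 0 and pi, so its sine never
    vanishes.\<close>
  define ang where "ang = (\<lambda>p. pi / 2 - arctan ((p - 1 + cos \<sigma>) / sin \<sigma>))"
  have sin_ang: "sin (ang t) \<noteq> 0" for t
    by (simp add: ang_def sin_diff)
  have cot_ang: "cot_par \<sigma> (ang t) = t" for t
    using \<open>sin \<sigma> \<noteq> 0\<close> by (simp add: ang_def cot_par_def tan_cot'[symmetric] tan_arctan)
  let ?\<alpha> = "ang p" and ?\<beta> = "ang q"
  let ?\<gamma> = "\<sigma> - ?\<alpha> - ?\<beta>"
  note sum = cot_par_sum[of ?\<alpha> ?\<beta> \<sigma>, OF sin_ang sin_ang, unfolded cot_ang]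
  have rel': "p * q - 2 + 2 * cos \<sigma> = r * (p * q - p - q)"
    using rel by (simp add: algebra_simps)
  have "cos \<sigma> > - 1"
  proof -
    have "cos \<sigma> \<noteq> - 1" using \<open>sin \<sigma> \<noteq> 0\<close> sin_cos_squared_add[of \<sigma>] by (auto simp: power2_eq_square)
    then show ?thesis using cos_ge_minus_one[of \<sigma>] by linarith
  qed
  \<comment> \<open>If the sine vanished, p and q would have equal sum and product, namely 2 - 2 cos
    \<sigma>, which lies strictly between 0 and 4; but (p + q)^2 \<ge> 4pq forces this value to be
    at least 4.\<close>
  have \<gamma>: "sin ?\<gamma> \<noteq> 0"
  proof
    assume "sin ?\<gamma> = 0"
    then have "p * q - p - q = 0" using sum(1) sin_ang by simp
    then have eq: "p + q = p * q" "p * q = 2 - 2 * cos \<sigma>" using rel' by auto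
    have "4 * (p * q) \<le> (p + q)\<^sup>2"
      using zero_le_power2[of "p - q"] by (simp add: power2_eq_square algebra_simps)
    then have "4 * (p * q) \<le> (p * q) * (p * q)" unfolding eq(1) by (simp add: power2_eq_square)
    moreover have "p * q > 0" 
      unfolding eq(2) using \<open>sin \<sigma> \<noteq> 0\<close> cos_le_one[of \<sigma>] sin_cos_squared_add[of \<sigma>]
      by (cases "cos \<sigma> = 1") (auto simp: less_le)
    ultimately have "4 \<le> p * q" by (simp add: mult_le_cancel_right)
    then show False using eq(2) \<open>cos \<sigma> > - 1\<close> by linarith
  qed
  have "cot_par \<sigma> ?\<gamma> * (sin \<sigma> * sin ?\<gamma>) = r * (sin \<sigma> * sin ?\<gamma>)"
    using sum(2)[OF \<gamma>] unfolding sum(1)[symmetric] rel' mult.assoc by (rule sym)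
  moreover have "sin \<sigma> * sin ?\<gamma> \<noteq> 0" by (rule no_zero_divisors) fact+
  ultimately have "cot_par \<sigma> ?\<gamma> = r" by (rule mult_right_cancel[THEN iffD1, rotated])
  then show thesis by (rule that[OF sin_ang sin_ang \<gamma> cot_ang cot_ang])
qed

lemma irrational_multiples_dense:
  fixes \<sigma> \<alpha> :: real
  assumes "\<sigma> / pi \<notin> \<rat>"
  obtains n :: "nat \<Rightarrow> nat" and k :: "nat \<Rightarrow> int"
  where "\<And>i. n i > 0" "(\<lambda>i. real (n i) * \<sigma> - of_int (k i) * pi) \<longlonglongrightarrow> \<alpha>"
proof -
  have "\<exists>(n::nat) k. n > 0 \<and> \<bar>real n * (\<sigma> / pi) - of_int k - \<alpha> / pi\<bar> < 1 / real (Suc i)" for i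
  proof -
    obtain k n where "n > 0" "\<bar>of_int n * (\<sigma> / pi) - of_int k - \<alpha> / pi\<bar> < 1 / real (Suc i)"
      by (rule sequence_of_fractional_parts_is_dense[OF assms, of "1 / real (Suc i)"]) auto
    then show ?thesis by (intro exI[of _ "nat n"] exI[of _ k]) auto
  qed
  then obtain n :: "nat \<Rightarrow> nat" and k :: "nat \<Rightarrow> int" where n: "\<And>i. n i > 0"
    and close: "\<And>i. \<bar>real (n i) * (\<sigma> / pi) - of_int (k i) - \<alpha> / pi\<bar> < 1 / real (Suc i)"
    by metis
  have "(\<lambda>i. real (n i) * (\<sigma> / pi) - of_int (k i) - \<alpha> / pi) \<longlonglongrightarrow> 0"
    by (rule Lim_null_comparison[OF _ lim_inverse_n'[THEN LIMSEQ_Suc]])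
      (use close in \<open>auto intro!: always_eventually less_imp_le\<close>)
  then have "(\<lambda>i. pi * (real (n i) * (\<sigma> / pi) - of_int (k i) - \<alpha> / pi) + \<alpha>) \<longlonglongrightarrow> pi * 0 + \<alpha>"
    by (intro tendsto_intros)
  then have "(\<lambda>i. real (n i) * \<sigma> - of_int (k i) * pi) \<longlonglongrightarrow> \<alpha>"
    by (simp add: algebra_simps)
  with n show thesis by (rule that)
qed

section \<open>A nilpotent quotient detecting torsion-type words\<close>

text \<open>The coefficient of s^2 in (1 + s)^k, also for negative k. Accordingly
  \<open>tri_add\<close> and \<open>tri_mult\<close> compare coefficients in (1 + s)^(j+k) and in
  ((1 + s)^j)^k.\<close>

definition tri :: "int \<Rightarrow> int" where
  "tri k = k * (k - 1) div 2"

lemma tri_double: "2 * tri k = k * (k - 1)"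
  unfolding tri_def by (rule dvd_mult_div_cancel) simp

lemma tri_add: "tri (j + k) = tri j + tri k + j * k"
proof -
  have "2 * tri (j + k) = 2 * (tri j + tri k + j * k)"
    unfolding distrib_left tri_double by (simp add: algebra_simps)
  then show ?thesis by simp
qed

lemma tri_mult: "tri (j * k) = j\<^sup>2 * tri k + k * tri j"
proof -
  have "2 * tri (j * k) = j\<^sup>2 * (2 * tri k) + k * (2 * tri j)"
    unfolding tri_double by (simp add: algebra_simps power2_eq_square)
  then show ?thesis by simp
qed

lemma tri_values [simp]: "tri 0 = 0" "tri 1 = 0" "tri (- 1) = 1"
  by (simp_all add: tri_def)

lemma tri_minus: "tri (- k) = tri k + k"
  using tri_add[of k "- k"] tri_add[of "-1" k] tri_double[of k] tri_double[of "-k"] by (simp add: algebra_simps)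

text \<open>
  The tuple \<open>(k, a, b, c)\<close> stands for \<open>(a + b s + c s\<^sup>2, t\<^sup>k)\<close> in \<open>\<int>[s]/(s\<^sup>3) \<rtimes> \<langle>t\<rangle>\<close>, where \<open>t\<close> acts
  as multiplication by \<open>1 + s\<close>.
\<close>

type_synonym jet = "int \<times> int \<times> int \<times> int"

fun jet_mult :: "jet \<Rightarrow> jet \<Rightarrow> jet" where
  "jet_mult (k, a, b, c) (k', a', b', c') =
     (k + k', a + a', b + b' + k * a', c + c' + k * b' + tri k * a')"

definition jet_group :: "jet monoid" where
  "jet_group = \<lparr>carrier = UNIV, mult = jet_mult, one = (0, 0, 0, 0)\<rparr>"

lemma jet_simps [simp]:
  "carrier jet_group = UNIV" "mult jet_group = jet_mult" "one jet_group = (0, 0, 0, 0)"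
  by (simp_all add: jet_group_def)

lemma jet_left_inverse:
  "jet_mult (- k, - a, k * a - b, k * b - c - tri (- k) * a) (k, a, b, c) = (0, 0, 0, 0)"
  by simp

lemma group_jet_group: "group jet_group"
proof (rule groupI)
  fix g :: jet
  obtain k a b c where "g = (k, a, b, c)" by (cases g)
  then show "\<exists>h\<in>carrier jet_group. h \<otimes>\<^bsub>jet_group\<^esub> g = \<one>\<^bsub>jet_group\<^esub>"
    using jet_left_inverse[of k a b c]
    by (intro bexI[of _ "(- k, - a, k * a - b, k * b - c - tri (- k) * a)"]) (simp_all del: jet_mult.simps)
qed (auto simp: tri_add algebra_simps)

interpretation jet: group jet_group
  by (rule group_jet_group)

lemma jet_inv [simp]:
  "inv\<^bsub>jet_group\<^esub> (k, a, b, c) = (- k, - a, k * a - b, k * b - c - tri (- k) * a)"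
  by (rule jet.inv_equality) (use jet_left_inverse in auto)

text \<open>The module part is multiplied by 1 + t^k + ... + t^((n-1)k) = n + k tri(n) s + .... The
  last coordinate is left open because it is central and cancels in commutators.\<close>

lemma jet_pow:
  fixes n :: nat and k a b c :: int
  obtains d where "(k, a, b, c) [^]\<^bsub>jet_group\<^esub> n = (n * k, n * a, n * b + k * tri n * a, d)"
proof -
  have "\<exists>d. (k, a, b, c) [^]\<^bsub>jet_group\<^esub> n = (n * k, n * a, n * b + k * tri n * a, d)"
  proof (induction n)
    case (Suc n)
    then obtain d where d: "(k, a, b, c) [^]\<^bsub>jet_group\<^esub> n = (n * k, n * a, n * b + k * tri n * a, d)"
      by blast
    have "tri (1 + int n) = tri n + n" using tri_add[of 1 "int n"] by simp
    then show ?case by (simp add: d algebra_simps)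
  qed (auto simp: jet_group_def)
  then show thesis using that by blast
qed

lemma jet_pow_kernel:
  fixes n :: nat and a b c :: int
  shows "(0, a, b, c) [^]\<^bsub>jet_group\<^esub> n = (0, n * a, n * b, n * c)"
  by (induction n) (simp_all add: algebra_simps)

lemma jet_int_pow_kernel:
  fixes i a b c :: int
  shows "(0, a, b, c) [^]\<^bsub>jet_group\<^esub> i = (0, i * a, i * b, i * c)"
  by (cases i rule: int_cases2)
    (simp_all add: jet_pow_kernel int_pow_int jet.int_pow_neg del: jet_simps(2))

lemma jet_int_pow_fst:
  fixes i :: int
  shows "fst (g [^]\<^bsub>jet_group\<^esub> i) = i * fst g"
proof -
  have n: "fst (g [^]\<^bsub>jet_group\<^esub> n) = int n * fst g" for n :: nat
  proof (cases g)
    case (fields k a b c)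
    then show ?thesis using jet_pow[of k a b c n] by (metis fst_conv)
  qed
  have inv: "fst (inv\<^bsub>jet_group\<^esub> h) = - fst h" for h :: jet
    by (cases h) simp
  show ?thesis
    by (cases i rule: int_cases2) (simp_all add: n inv int_pow_int jet.int_pow_neg)
qed

text \<open>
  This is the ideal generated by \<open>q s\<close> with \<open>q = (t\<^sup>k\<^sup>m - 1) / (t\<^sup>k - 1) = m + k tri(m) s + \<dots>\<close>. Modulo
  it, the \<open>m\<close>th power of any element over \<open>t\<^sup>k\<close> is central.
\<close>

definition jet_ideal :: "int \<Rightarrow> int \<Rightarrow> jet set" where
  "jet_ideal k m = {(0, 0, m * \<alpha>, k * tri m * \<alpha> + m * \<beta>) | \<alpha> \<beta>. True}"

lemma jet_idealI:
  "x = m * \<alpha> \<Longrightarrow> y = k * tri m * \<alpha> + m * \<beta> \<Longrightarrow> (0, 0, x, y) \<in> jet_ideal k m"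
  by (auto simp: jet_ideal_def)

lemma jet_idealE:
  assumes "g \<in> jet_ideal k m"
  obtains \<alpha> \<beta> where "g = (0, 0, m * \<alpha>, k * tri m * \<alpha> + m * \<beta>)"
  using assms by (auto simp: jet_ideal_def)

lemma jet_ideal_normal: "jet_ideal k m \<lhd> jet_group"
proof -
  have "subgroup (jet_ideal k m) jet_group"
  proof (rule jet.subgroupI)
    show "jet_ideal k m \<noteq> {}" by (auto simp: jet_ideal_def)
    show "inv\<^bsub>jet_group\<^esub> g \<in> jet_ideal k m" if "g \<in> jet_ideal k m" for g
      using that
    proof (rule jet_idealE)
      fix \<alpha> \<beta> assume g: "g = (0, 0, m * \<alpha>, k * tri m * \<alpha> + m * \<beta>)"
      show ?thesis unfolding g by (auto intro: jet_idealI[where \<alpha> = "- \<alpha>" and \<beta> = "- \<beta>"])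
    qed
    show "g \<otimes>\<^bsub>jet_group\<^esub> h \<in> jet_ideal k m" if g: "g \<in> jet_ideal k m" and h: "h \<in> jet_ideal k m" for g h
    proof (rule jet_idealE[OF g], rule jet_idealE[OF h])
      fix \<alpha> \<beta> \<alpha>' \<beta>' assume eq: "g = (0, 0, m * \<alpha>, k * tri m * \<alpha> + m * \<beta>)"
        "h = (0, 0, m * \<alpha>', k * tri m * \<alpha>' + m * \<beta>')"
      show ?thesis unfolding eq
        by (auto simp: algebra_simps intro: jet_idealI[where \<alpha> = "\<alpha> + \<alpha>'" and \<beta> = "\<beta> + \<beta>'"])
    qed
  qed simp
  moreover have "h \<otimes>\<^bsub>jet_group\<^esub> g \<otimes>\<^bsub>jet_group\<^esub> inv\<^bsub>jet_group\<^esub> h \<in> jet_ideal k m"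
    if "g \<in> jet_ideal k m" for g h
    using that
  proof (rule jet_idealE)
    fix \<alpha> \<beta> assume g: "g = (0, 0, m * \<alpha>, k * tri m * \<alpha> + m * \<beta>)"
    obtain j a b c where h: "h = (j, a, b, c)" by (cases h)
    \<comment> \<open>Conjugation by \<open>h\<close> acts as multiplication by (1 + s)^j, which
      sends \<alpha> + \<beta> s to \<alpha> + (\<beta> + j \<alpha>) s modulo s^2.\<close>
    have "h \<otimes>\<^bsub>jet_group\<^esub> g \<otimes>\<^bsub>jet_group\<^esub> inv\<^bsub>jet_group\<^esub> h
        = (0, 0, m * \<alpha>, k * tri m * \<alpha> + m * (\<beta> + j * \<alpha>))"
      using tri_double[of j] by (simp add: g h tri_minus algebra_simps) algebra
    then show ?thesis by (auto intro: jet_idealI)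
  qed
  ultimately show ?thesis by (simp add: jet.normal_inv_iff)
qed

lemma jet_pow_central:
  fixes m :: nat
  assumes "fst r = k"
  shows "g \<otimes>\<^bsub>jet_group\<^esub> r [^]\<^bsub>jet_group\<^esub> m \<otimes>\<^bsub>jet_group\<^esub> inv\<^bsub>jet_group\<^esub> (r [^]\<^bsub>jet_group\<^esub> m \<otimes>\<^bsub>jet_group\<^esub> g)
       \<in> jet_ideal k m"
proof -
  obtain a b c where r: "r = (k, a, b, c)" using assms by (cases r) auto
  obtain j a' b' c' where g: "g = (j, a', b', c')" by (cases g)
  obtain d where d: "r [^]\<^bsub>jet_group\<^esub> m = (m * k, m * a, m * b + k * tri m * a, d)"
    unfolding r by (rule jet_pow)
  define x where "x = r [^]\<^bsub>jet_group\<^esub> m"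
  \<comment> \<open>Let \<rho> and \<gamma> be the module parts of \<open>r\<close> and
    \<open>g\<close>. As t^(km) - 1 = q (t^k - 1), the commutator is q ((t^j - 1) \<rho> - (t^k - 1)
    \<gamma>); \<alpha> and \<beta> are the coefficients of s and s^2 in the outer bracket.\<close>
  define \<alpha> where "\<alpha> = j * a - k * a'"
  define \<beta> where "\<beta> = j * b - k * b' + tri j * a - tri k * a'"
  have com: "g \<otimes>\<^bsub>jet_group\<^esub> x = (0, 0, m * \<alpha>, k * tri m * \<alpha> + m * \<beta>) \<otimes>\<^bsub>jet_group\<^esub> (x \<otimes>\<^bsub>jet_group\<^esub> g)"
    unfolding x_def d g \<alpha>_def \<beta>_def
    by (simp add: tri_mult[of k "int m"] algebra_simps power2_eq_square)
  have "g \<otimes>\<^bsub>jet_group\<^esub> x \<otimes>\<^bsub>jet_group\<^esub> inv\<^bsub>jet_group\<^esub> (x \<otimes>\<^bsub>jet_group\<^esub> g)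
     = (0, 0, m * \<alpha>, k * tri m * \<alpha> + m * \<beta>)"
    unfolding com by (rule jet.inv_solve_right'[THEN iffD2]) auto
  then show ?thesis unfolding x_def jet_ideal_def by auto
qed

text \<open>Modulo the ideal, \<open>u\<close> would map to the i-th power of the image of r^m.
  Comparing powers of t gives k = 0 or i = 0, and in both cases the last coordinate exhibits 1 as a
  multiple of \<open>m\<close>.\<close>

lemma not_torsion_type_jet:
  assumes \<phi>: "\<phi> \<in> hom F2 jet_group" and u: "\<phi> u = (0, 0, 0, 1)"
  shows "\<not> torsion_type u"
proof
  assume "torsion_type u"
  then obtain m :: nat and r where m: "m \<ge> 2" and r: "r \<in> carrier F2"
    and ur: "u \<in> normal_closure F2 {r [^]\<^bsub>F2\<^esub> m}"
    by (auto simp: torsion_type_def)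
  interpret F2: group F2 by (rule group_free_group)
  define k where "k = fst (\<phi> r)"
  have rm: "\<phi> (r [^]\<^bsub>F2\<^esub> m) = \<phi> r [^]\<^bsub>jet_group\<^esub> m"
    using \<phi> r group_free_group group_jet_group
    by (intro group_hom.hom_nat_pow) (auto simp: group_hom_def group_hom_axioms_def)
  obtain i :: int where "\<phi> u \<otimes>\<^bsub>jet_group\<^esub> inv\<^bsub>jet_group\<^esub> ((\<phi> r [^]\<^bsub>jet_group\<^esub> m) [^]\<^bsub>jet_group\<^esub> i) \<in> jet_ideal k m"
    using jet.normal_closure_central_mod[OF group_free_group \<phi> jet_ideal_normal[of k m] F2.nat_pow_closed[OF r, of m] _ ur]
      jet_pow_central[OF k_def[symmetric]]
    unfolding rm by blast
  then obtain \<alpha> \<beta> :: int where mem: "(0, 0, 0, 1) \<otimes>\<^bsub>jet_group\<^esub> inv\<^bsub>jet_group\<^esub> ((\<phi> r [^]\<^bsub>jet_group\<^esub> m) [^]\<^bsub>jet_group\<^esub> i)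
      = (0, 0, m * \<alpha>, k * tri m * \<alpha> + m * \<beta>)"
    unfolding u by (rule jet_idealE)
  have "fst ((\<phi> r [^]\<^bsub>jet_group\<^esub> m) [^]\<^bsub>jet_group\<^esub> i) = i * (m * k)"
  proof -
    have "fst (\<phi> r [^]\<^bsub>jet_group\<^esub> m) = m * k"
      using jet_int_pow_fst[of "\<phi> r" "int m"] by (simp add: int_pow_int k_def)
    then show ?thesis by (simp add: jet_int_pow_fst)
  qed
  moreover have "fst ((0, 0, 0, 1) \<otimes>\<^bsub>jet_group\<^esub> inv\<^bsub>jet_group\<^esub> g) = - fst g" for g :: jet
    by (cases g) simp
  ultimately have ik: "i * (m * k) = 0" using mem by (metis fst_conv neg_equal_0_iff_equal)
  have "\<exists>e. int m * e = 1"
  proof (cases "k = 0")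
    case True
    then obtain a b c where "\<phi> r = (0, a, b, c)" by (cases "\<phi> r") (auto simp: k_def)
    with mem True have "1 - i * (m * c) = m * \<beta>"
      by (simp add: jet_pow_kernel jet_int_pow_kernel)
    then have "int m * (\<beta> + i * c) = 1" by (simp add: algebra_simps)
    then show ?thesis by blast
  next
    case False
    then have "i = 0" using ik m by auto
    with mem have "m * \<alpha> = 0" "k * tri m * \<alpha> + m * \<beta> = 1" by auto
    then show ?thesis using m by auto
  qed
  then have "int m dvd 1" by (metis dvd_triv_left)
  then show False using m by simp
qed

section \<open>The palindromic kernel words\<close>

definition comm1 :: F2_word where
  "comm1 = [(GX, True), (GY, True), (GX, False), (GY, False)]"
definition comm2 :: F2_word where
  "comm2 = [(GY, True), (GX, False), (GY, False), (GX, True)]"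
definition comm3 :: F2_word where
  "comm3 = [(GY, False), (GX, False), (GY, True), (GX, True)]"

text \<open>
  The conjugation by a power of \<open>X\<close> normalises the image of the word in \<^const>\<open>jet_group\<close> to
  \<open>(0, 0, 1, 0)\<close>.
\<close>

definition half_word :: "nat \<Rightarrow> nat \<Rightarrow> F2_word" where
  "half_word n m = concat (replicate n [(GX, False)]) @ concat (replicate (Suc n) comm1)
     @ concat (replicate m comm2) @ concat (replicate (n + m) comm3) @ concat (replicate n [(GX, True)])"

definition kernel_word :: "nat \<Rightarrow> nat \<Rightarrow> F2_word" where
  "kernel_word n m = normal_form (half_word n m @ rev (half_word n m))"

lemma palindromic_kernel_word: "palindromic (kernel_word n m)"
  unfolding kernel_word_def by (rule palindromic_normal_form) simp

context group
begin

lemma word_eval_half_word: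
  assumes "\<And>a. f a \<in> carrier G"
  shows "word_eval G f (half_word n m) = inv (f GX) [^] n \<otimes> (word_eval G f comm1 [^] Suc n
    \<otimes> word_eval G f comm2 [^] m \<otimes> word_eval G f comm3 [^] (n + m)) \<otimes> f GX [^] n"
proof -
  have closed: "word_eval G f w \<in> carrier G" for w by (rule word_eval_closed[OF assms])
  have letter: "word_eval G f [(GX, s)] = (if s then f GX else inv (f GX))" for s
    using assms by (simp add: word_eval_Cons)
  show ?thesis
    unfolding half_word_def word_eval_append[OF assms] word_eval_concat_replicate[OF assms] letter
    using assms closed by (simp add: m_assoc del: nat_pow_Suc)
qed

lemma word_eval_kernel_word:
  assumes "\<And>a. f a \<in> carrier G"
  shows "word_eval G f (kernel_word n m)
       = word_eval G f (half_word n m) \<otimes> inv (word_eval G (\<lambda>a. inv (f a)) (half_word n m))"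
  using assms by (simp add: kernel_word_def word_eval_normal_form word_eval_append word_eval_rev)

end

section \<open>Images of the kernel words in the nilpotent group and in PSL(2,R)\<close>

lemma not_torsion_type_kernel_word: "\<not> torsion_type (kernel_word n m)"
proof (rule not_torsion_type_jet)
  \<comment> \<open>X maps to t and Y to the module element 1.\<close>
  define f :: "F2_gen \<Rightarrow> jet" where "f = case_F2_gen (1, 0, 0, 0) (0, 1, 0, 0)"
  show "word_eval jet_group f \<in> hom F2 jet_group"
    by (rule jet.word_eval_hom) simp
  have pow_X: "(\<epsilon>, 0, 0, 0) [^]\<^bsub>jet_group\<^esub> l = (\<epsilon> * int l, 0, 0, 0)" for \<epsilon> l
    by (induction l) (simp_all add: algebra_simps)
  \<comment> \<open>The three commutators map to s, s - s^2 and -s + s^2, so the middle part gives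
    (n+1)s + m(s - s^2) + (n+m)(-s + s^2) = s + n s^2. Conjugation by X^(-n) removes n s^2.\<close>
  have "word_eval jet_group f (half_word n m) = (0, 0, 1, 0)"
    by (subst jet.word_eval_half_word)
      (simp_all add: comm1_def comm2_def comm3_def jet.word_eval_Cons f_def pow_X jet_pow_kernel algebra_simps del: nat_pow_Suc)
  \<comment> \<open>With inverted generators the commutators map to s - s^2, s and -s, which add up
    to s - (n+1) s^2; the conjugation now adds n s^2. The quotient of the two values is s^2.\<close>
  moreover have "word_eval jet_group (\<lambda>a. inv\<^bsub>jet_group\<^esub> (f a)) (half_word n m) = (0, 0, 1, - 1)"
    by (subst jet.word_eval_half_word)
      (simp_all add: comm1_def comm2_def comm3_def jet.word_eval_Cons f_def pow_X jet_pow_kernel algebra_simps del: nat_pow_Suc)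
  ultimately show "word_eval jet_group f (kernel_word n m) = (0, 0, 0, 1)"
    by (subst jet.word_eval_kernel_word) simp_all
qed

text \<open>The assignment is arbitrary so that the lemma applies both to the holonomy generators
  and to their inverses, the latter accounting for the reversed half. The angles (n+1)\<sigma>,
  m\<sigma> and -(n+m)\<sigma> add up to \<sigma>.\<close>

lemma half_word_trivial:
  fixes f :: "F2_gen \<Rightarrow> real^2^2" and \<sigma> x y z :: real
  assumes f: "\<And>a. f a \<in> carrier SL2R"
    and tr: "trace (word_eval SL2R f comm1) = - 2 * cos \<sigma>"
    and sin: "sin \<sigma> \<noteq> 0" "sin (real (Suc n) * \<sigma>) \<noteq> 0" "sin (real m * \<sigma>) \<noteq> 0" "sin (real (n + m) * \<sigma>) \<noteq> 0"
    and pos: "x > 0" "y > 0" "z > 0"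
    and rel: "(y *\<^sub>R word_eval SL2R f comm1 + mat (y - x * z)) ** (z *\<^sub>R word_eval SL2R f comm2 + mat (z - x * y))
      = \<mu> *\<^sub>R (x *\<^sub>R word_eval SL2R f comm3 + mat (x - y * z))"
    and par: "x * z / y = cot_par \<sigma> (real (Suc n) * \<sigma>)" "x * y / z = cot_par \<sigma> (real m * \<sigma>)"
      "y * z / x = cot_par \<sigma> (- (real (n + m) * \<sigma>))"
  shows "word_eval SL2R f (half_word n m) \<in> {mat 1, - mat 1}"
proof -
  interpret group SL2R by (rule group_SL2R)
  define W1 W2 W3 where "W1 = word_eval SL2R f comm1" and "W2 = word_eval SL2R f comm2"
    and "W3 = word_eval SL2R f comm3"
  have W: "W1 \<in> carrier SL2R" "W2 \<in> carrier SL2R" "W3 \<in> carrier SL2R"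
    unfolding W1_def W2_def W3_def by (rule word_eval_closed[OF f])+
  let ?a = "f GX" and ?b = "f GY"
  \<comment> \<open>These groupings show that \<open>W2\<close> and the inverse of \<open>W3\<close>
    arise from \<open>W1\<close> by exchanging two factors, which preserves the trace.\<close>
  have W1: "W1 = ?a \<otimes>\<^bsub>SL2R\<^esub> (?b \<otimes>\<^bsub>SL2R\<^esub> inv\<^bsub>SL2R\<^esub> ?a \<otimes>\<^bsub>SL2R\<^esub> inv\<^bsub>SL2R\<^esub> ?b)"
      "W1 = (?a \<otimes>\<^bsub>SL2R\<^esub> ?b) \<otimes>\<^bsub>SL2R\<^esub> (inv\<^bsub>SL2R\<^esub> ?a \<otimes>\<^bsub>SL2R\<^esub> inv\<^bsub>SL2R\<^esub> ?b)"
    and W2: "W2 = (?b \<otimes>\<^bsub>SL2R\<^esub> inv\<^bsub>SL2R\<^esub> ?a \<otimes>\<^bsub>SL2R\<^esub> inv\<^bsub>SL2R\<^esub> ?b) \<otimes>\<^bsub>SL2R\<^esub> ?a"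
    and W3: "inv\<^bsub>SL2R\<^esub> W3 = (inv\<^bsub>SL2R\<^esub> ?a \<otimes>\<^bsub>SL2R\<^esub> inv\<^bsub>SL2R\<^esub> ?b) \<otimes>\<^bsub>SL2R\<^esub> (?a \<otimes>\<^bsub>SL2R\<^esub> ?b)"
    using f by (simp_all add: W1_def W2_def W3_def comm1_def comm2_def comm3_def word_eval_Cons
        m_assoc inv_mult_group)
  have tr2: "trace W2 = trace W1" and tr3: "trace (inv\<^bsub>SL2R\<^esub> W3) = trace W1"
    unfolding W2 W3 by (subst W1(1), simp only: SL2R_simps, rule trace_mult_commute)
      (subst W1(2), simp only: SL2R_simps, rule trace_mult_commute)
  have "W1 [^]\<^bsub>SL2R\<^esub> Suc n \<otimes>\<^bsub>SL2R\<^esub> W2 [^]\<^bsub>SL2R\<^esub> m \<otimes>\<^bsub>SL2R\<^esub> inv\<^bsub>SL2R\<^esub> (inv\<^bsub>SL2R\<^esub> W3) [^]\<^bsub>SL2R\<^esub> (n + m)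
      \<in> {mat 1, - mat 1}"
  proof (rule rotation_product)
    have div: "W + mat (1 - p / s) = (1 / s) *\<^sub>R (s *\<^sub>R W + mat (s - p))" if "s > 0" for W :: "real^2^2" and s p
      using that by (cases W rule: mat2_cases) (simp add: mat2_simps mat2_eq_iff field_simps)
    show "(W1 + mat (1 - cot_par \<sigma> (real (Suc n) * \<sigma>))) ** (W2 + mat (1 - cot_par \<sigma> (real m * \<sigma>)))
        = (1 / y * (1 / z) * \<mu> * x) *\<^sub>R (inv\<^bsub>SL2R\<^esub> (inv\<^bsub>SL2R\<^esub> W3) + mat (1 - cot_par \<sigma> (- (real (n + m) * \<sigma>))))"
      unfolding par[symmetric] inv_inv[OF W(3)] div[OF pos(1)] div[OF pos(2)] div[OF pos(3)]
        scaleR_mat_mult rel[folded W1_def W2_def W3_def]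
      using pos by simp
  qed (use W tr tr2 tr3 sin in \<open>simp_all add: W1_def\<close>)
  then have core: "W1 [^]\<^bsub>SL2R\<^esub> Suc n \<otimes>\<^bsub>SL2R\<^esub> W2 [^]\<^bsub>SL2R\<^esub> m \<otimes>\<^bsub>SL2R\<^esub> W3 [^]\<^bsub>SL2R\<^esub> (n + m) \<in> {mat 1, - mat 1}"
    using W(3) by (simp del: nat_pow_Suc)
  have "inv\<^bsub>SL2R\<^esub> ?a [^]\<^bsub>SL2R\<^esub> n \<otimes>\<^bsub>SL2R\<^esub> ?a [^]\<^bsub>SL2R\<^esub> n = mat 1"
    using f by (simp add: nat_pow_inv SL2R_simps(3)[symmetric])
  with core show ?thesis
    unfolding word_eval_half_word[OF f] W1_def[symmetric] W2_def[symmetric] W3_def[symmetric]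
    by (auto simp: SL2R_simps(2) neg_mat_mult simp del: nat_pow_Suc)
qed

lemma kernel_word_in_kernel:
  fixes \<theta> \<sigma> x y z :: real
  assumes \<xi>: "(x, y, z) \<in> fricke_klein \<theta>"
    and \<sigma>: "\<sigma> = \<theta> / 2"
    and sin: "sin \<sigma> \<noteq> 0" "sin (real (Suc n) * \<sigma>) \<noteq> 0" "sin (real m * \<sigma>) \<noteq> 0" "sin (real (n + m) * \<sigma>) \<noteq> 0"
    and par: "x * z / y = cot_par \<sigma> (real (Suc n) * \<sigma>)" "x * y / z = cot_par \<sigma> (real m * \<sigma>)"
      "y * z / x = cot_par \<sigma> (- (real (n + m) * \<sigma>))"
  shows "kernel_word n m \<in> kernel F2 PSL2R (holonomy (x, y, z))"
proof -
  interpret SL: group SL2R by (rule group_SL2R)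
  let ?\<xi> = "(x, y, z)"
  define f where "f = hol_gen ?\<xi>"
  have f: "f a \<in> carrier SL2R" for a unfolding f_def by (rule hol_gen_closed[OF \<xi>])
  have f': "inv\<^bsub>SL2R\<^esub> (f a) \<in> carrier SL2R" for a using f by simp
  have pos: "x > 0" "y > 0" "z > 2"
    and fk: "x\<^sup>2 + y\<^sup>2 + z\<^sup>2 - x * y * z - 2 = - 2 * cos \<sigma>"
    using \<xi> by (auto simp: fricke_klein_def \<sigma>)
  define \<zeta> \<eta> where "\<zeta> = hol_zeta z" and "\<eta> = inverse \<zeta>"
  have \<zeta>: "\<zeta> * \<eta> = 1" "z = \<zeta> + \<eta>"
    using hol_zeta[OF pos(3)] by (auto simp: \<zeta>_def \<eta>_def)
  have gen: "f GX = mat2 x (- 1) 1 0" "f GY = mat2 0 \<eta> (- \<zeta>) y"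
    by (simp_all add: f_def mat2_def \<zeta>_def \<eta>_def)
  have inv: "inv\<^bsub>SL2R\<^esub> (f GX) = mat2 0 1 (- 1) x" "inv\<^bsub>SL2R\<^esub> (f GY) = mat2 y (- \<eta>) \<zeta> 0"
    unfolding gen using \<zeta>(1) by (auto simp: inv_mat2 mult.commute)
  have inv': "inv\<^bsub>SL2R\<^esub> (mat2 x (- 1) 1 0) = mat2 0 1 (- 1) x" "inv\<^bsub>SL2R\<^esub> (mat2 0 \<eta> (- \<zeta>) y) = mat2 y (- \<eta>) \<zeta> 0"
    "inv\<^bsub>SL2R\<^esub> (mat2 0 1 (- 1) x) = mat2 x (- 1) 1 0" "inv\<^bsub>SL2R\<^esub> (mat2 y (- \<eta>) \<zeta> 0) = mat2 0 \<eta> (- \<zeta>) y"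
    using \<zeta>(1) by (auto simp: inv_mat2 mult.commute)
  have one: "A ** mat 1 = A" for A :: "real^2^2" by simp
  note eval = comm1_def comm2_def comm3_def SL.word_eval_Cons inv inv' SL2R_simps(2,3) one matrix_mul_assoc
  have "word_eval SL2R f (half_word n m) \<in> {mat 1, - mat 1}"
  proof (rule half_word_trivial[OF f _ sin])
    show "trace (word_eval SL2R f comm1) = - 2 * cos \<sigma>"
      using trace_commutator(1)[OF \<zeta>(1), of x y, folded \<zeta>(2)] fk
      by (simp add: eval gen)
    show "(y *\<^sub>R word_eval SL2R f comm1 + mat (y - x * z)) ** (z *\<^sub>R word_eval SL2R f comm2 + mat (z - x * y))
      = (x*y*z - y\<^sup>2 - z\<^sup>2) *\<^sub>R (x *\<^sub>R word_eval SL2R f comm3 + mat (x - y * z))"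
      using triangle_relation(1)[OF \<zeta>(1), of y x, folded \<zeta>(2)] by (simp add: eval gen)
  qed (use pos par in auto)
  \<comment> \<open>Inverting both generators is the hyperelliptic involution, under which the trace
    and triangle identities persist.\<close>
  moreover have "word_eval SL2R (\<lambda>a. inv\<^bsub>SL2R\<^esub> (f a)) (half_word n m) \<in> {mat 1, - mat 1}"
  proof (rule half_word_trivial[OF f' _ sin])
    show "trace (word_eval SL2R (\<lambda>a. inv\<^bsub>SL2R\<^esub> (f a)) comm1) = - 2 * cos \<sigma>"
      using trace_commutator(2)[OF \<zeta>(1), of x y, folded \<zeta>(2)] fk
      by (simp add: eval)
    show "(y *\<^sub>R word_eval SL2R (\<lambda>a. inv\<^bsub>SL2R\<^esub> (f a)) comm1 + mat (y - x * z)) **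
        (z *\<^sub>R word_eval SL2R (\<lambda>a. inv\<^bsub>SL2R\<^esub> (f a)) comm2 + mat (z - x * y))
      = (x*y*z - y\<^sup>2 - z\<^sup>2) *\<^sub>R (x *\<^sub>R word_eval SL2R (\<lambda>a. inv\<^bsub>SL2R\<^esub> (f a)) comm3 + mat (x - y * z))"
      using triangle_relation(2)[OF \<zeta>(1), of y x, folded \<zeta>(2)] by (simp add: eval)
  qed (use pos par in auto)
  moreover have "inv\<^bsub>SL2R\<^esub> (- mat 1) = - mat 1" "inv\<^bsub>SL2R\<^esub> (mat 1) = mat 1"
    using inv_mat2[of 1 1 0 0] inv_mat2[of "- 1" "- 1" 0 0] by (simp_all add: mat2_simps)
  ultimately have "hol_lift ?\<xi> (kernel_word n m) \<in> {mat 1, - mat 1}"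
    unfolding hol_lift_def f_def[symmetric] SL.word_eval_kernel_word[OF f]
    by (auto simp: SL2R_simps neg_mat_mult)
  then have "holonomy ?\<xi> (kernel_word n m) = {mat 1, - mat 1}"
    unfolding holonomy_def to_PSL2R_def r_coset_def by (auto simp: SL2R_simps neg_mat_mult)
  then show ?thesis
    by (auto simp: kernel_def kernel_word_def normal_form_closed PSL2R_def FactGroup_def)
qed

section \<open>Density\<close>

lemma cot_par_minus_int_pi: "cot_par \<sigma> (t - of_int k * pi) = cot_par \<sigma> t"
proof -
  have "sin (of_int k * pi) = 0" using sin_npi_int[of k] by (simp add: mult.commute)
  moreover from this have "cos (of_int k * pi) \<noteq> 0"
    using sin_cos_squared_add[of "of_int k * pi"] by auto
  ultimately show ?thesis by (simp add: cot_par_def cot_def sin_diff cos_diff)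
qed

lemma sin_irrational_multiple:
  assumes "\<sigma> / pi \<notin> \<rat>" "n > 0"
  shows "sin (real n * \<sigma>) \<noteq> 0"
proof
  assume "sin (real n * \<sigma>) = 0"
  then obtain i :: int where "real n * \<sigma> = of_int i * pi" by (auto simp: sin_zero_iff_int2)
  then have "\<sigma> / pi = of_int i / of_nat n" using assms(2) by (simp add: field_simps)
  then show False using assms(1) by simp
qed

lemma fricke_klein_param:
  fixes p q r \<theta> :: real
  assumes rel: "p * q + q * r + p * r - p * q * r = 2 - 2 * cos (\<theta> / 2)"
    and pos: "p > 0" "q > 0" "r > 0"
    and gt: "sqrt (p * q) > 2" "sqrt (q * r) > 2" "sqrt (p * r) > 2"
  shows "(sqrt (p * q), sqrt (q * r), sqrt (p * r)) \<in> fricke_klein \<theta>"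
    and "sqrt (p * q) * sqrt (p * r) / sqrt (q * r) = p"
    and "sqrt (p * q) * sqrt (q * r) / sqrt (p * r) = q"
    and "sqrt (q * r) * sqrt (p * r) / sqrt (p * q) = r"
proof -
  have "sqrt (p * q) * sqrt (q * r) * sqrt (p * r) = (sqrt p)\<^sup>2 * (sqrt q)\<^sup>2 * (sqrt r)\<^sup>2"
    unfolding real_sqrt_mult power2_eq_square by (simp only: mult_ac)
  also have "\<dots> = p * q * r" using pos by simp
  finally show "(sqrt (p * q), sqrt (q * r), sqrt (p * r)) \<in> fricke_klein \<theta>"
    using gt rel pos by (simp add: fricke_klein_def)
qed (use pos in \<open>simp_all add: real_sqrt_mult\<close>)

lemma fricke_klein_param_surj:
  assumes "(x, y, z) \<in> fricke_klein \<theta>"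
  defines "p \<equiv> x * z / y" and "q \<equiv> x * y / z" and "r \<equiv> y * z / x"
  shows "p * q + q * r + p * r - p * q * r = 2 - 2 * cos (\<theta> / 2)"
    and "x = sqrt (p * q)" and "y = sqrt (q * r)" and "z = sqrt (p * r)"
    and "p > 0" "q > 0" "r > 0"
proof -
  have pos: "x > 0" "y > 0" "z > 0" and fk: "x\<^sup>2 + y\<^sup>2 + z\<^sup>2 - x * y * z - 2 = - 2 * cos (\<theta> / 2)"
    using assms(1) by (auto simp: fricke_klein_def)
  have "p * q = x\<^sup>2" "q * r = y\<^sup>2" "p * r = z\<^sup>2" "x\<^sup>2 * r = x * y * z"
    unfolding p_def q_def r_def power2_eq_square using pos by simp_all
  with fk pos show "p * q + q * r + p * r - p * q * r = 2 - 2 * cos (\<theta> / 2)"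
    "x = sqrt (p * q)" "y = sqrt (q * r)" "z = sqrt (p * r)"
    by (simp_all add: algebra_simps)
  show "p > 0" "q > 0" "r > 0" using pos by (simp_all add: p_def q_def r_def)
qed

text \<open>Only two angles are approximated and the third is defined as their complement to
  \<sigma>. The approximants therefore satisfy the Fricke--Klein equation exactly, and only the
  strict inequalities depend on the limit.\<close>

lemma fricke_klein_approximation:
  fixes \<theta> :: real
  assumes irr: "\<theta> / pi \<notin> \<rat>" and \<xi>: "\<xi> \<in> fricke_klein \<theta>"
  obtains \<xi>' where "\<xi>' \<longlonglongrightarrow> \<xi>"
    "\<forall>\<^sub>F i in sequentially. \<xi>' i \<in> fricke_klein \<theta> \<and>
       (\<exists>n m. kernel_word n m \<in> kernel F2 PSL2R (holonomy (\<xi>' i)))"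
proof -
  define \<sigma> where "\<sigma> = \<theta> / 2"
  have \<sigma>: "\<sigma> / pi \<notin> \<rat>"
  proof
    assume "\<sigma> / pi \<in> \<rat>"
    then have "2 * (\<sigma> / pi) \<in> \<rat>" by (rule Rats_mult[OF Rats_number_of])
    then show False using irr by (simp add: \<sigma>_def)
  qed
  have sin: "sin (real n * \<sigma>) \<noteq> 0" if "n > 0" for n
    using sin_irrational_multiple[OF \<sigma> that] .
  have sin1: "sin \<sigma> \<noteq> 0" using sin[of 1] by simp
  obtain x y z where \<xi>_eq: "\<xi> = (x, y, z)" by (cases \<xi>)
  define p q r where "p = x * z / y" and "q = x * y / z" and "r = y * z / x"
  note param = fricke_klein_param_surj[OF \<xi>[unfolded \<xi>_eq], folded p_def q_def r_def]
  obtain \<alpha> \<beta> where ang: "sin \<alpha> \<noteq> 0" "sin \<beta> \<noteq> 0" "sin (\<sigma> - \<alpha> - \<beta>) \<noteq> 0"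
    and par: "cot_par \<sigma> \<alpha> = p" "cot_par \<sigma> \<beta> = q" "cot_par \<sigma> (\<sigma> - \<alpha> - \<beta>) = r"
    using cot_par_solve[OF param(1)[folded \<sigma>_def] sin1] by blast
  obtain n k where n: "\<And>i. n i > (0::nat)" "(\<lambda>i. real (n i) * \<sigma> - of_int (k i) * pi) \<longlonglongrightarrow> \<alpha>"
    using irrational_multiples_dense[OF \<sigma>] by blast
  obtain m l where m: "\<And>i. m i > (0::nat)" "(\<lambda>i. real (m i) * \<sigma> - of_int (l i) * pi) \<longlonglongrightarrow> \<beta>"
    using irrational_multiples_dense[OF \<sigma>] by blast
  define p' q' r' where "p' = (\<lambda>i. cot_par \<sigma> (n i * \<sigma>))" and "q' = (\<lambda>i. cot_par \<sigma> (m i * \<sigma>))"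
    and "r' = (\<lambda>i. cot_par \<sigma> (\<sigma> - n i * \<sigma> - m i * \<sigma>))"
  have cot_tendsto: "(\<lambda>i. cot_par \<sigma> (g i)) \<longlonglongrightarrow> cot_par \<sigma> t" if "g \<longlonglongrightarrow> t" "sin t \<noteq> 0" for g t
    unfolding cot_par_def by (intro tendsto_add tendsto_mult tendsto_const isCont_tendsto_compose[OF isCont_cot] that)
  have p': "p' \<longlonglongrightarrow> p"
    using cot_tendsto[OF n(2) ang(1)] by (simp add: cot_par_minus_int_pi p'_def par)
  have q': "q' \<longlonglongrightarrow> q"
    using cot_tendsto[OF m(2) ang(2)] by (simp add: cot_par_minus_int_pi q'_def par)
  have "(\<lambda>i. \<sigma> - (real (n i) * \<sigma> - of_int (k i) * pi) - (real (m i) * \<sigma> - of_int (l i) * pi)) \<longlonglongrightarrow> \<sigma> - \<alpha> - \<beta>"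
    using n(2) m(2) by (intro tendsto_intros)
  from cot_tendsto[OF this ang(3)]
  have "(\<lambda>i. cot_par \<sigma> (\<sigma> - (real (n i) * \<sigma> - of_int (k i) * pi) - (real (m i) * \<sigma> - of_int (l i) * pi))) \<longlonglongrightarrow> r"
    unfolding par(3) .
  moreover have "cot_par \<sigma> (\<sigma> - (real (n i) * \<sigma> - of_int (k i) * pi) - (real (m i) * \<sigma> - of_int (l i) * pi)) = r' i" for i
    using cot_par_minus_int_pi[of \<sigma> "\<sigma> - n i * \<sigma> - m i * \<sigma>" "- (k i + l i)"]
    by (simp add: r'_def algebra_simps)
  ultimately have r': "r' \<longlonglongrightarrow> r" by simp
  define \<xi>' where "\<xi>' = (\<lambda>i. (sqrt (p' i * q' i), sqrt (q' i * r' i), sqrt (p' i * r' i)))"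
  have sqrt: "(\<lambda>i. sqrt (p' i * q' i)) \<longlonglongrightarrow> x" "(\<lambda>i. sqrt (q' i * r' i)) \<longlonglongrightarrow> y"
    "(\<lambda>i. sqrt (p' i * r' i)) \<longlonglongrightarrow> z"
    unfolding param(2-4) by (rule tendsto_real_sqrt tendsto_mult p' q' r')+
  have lim: "\<xi>' \<longlonglongrightarrow> \<xi>"
    unfolding \<xi>'_def \<xi>_eq using sqrt by (intro tendsto_Pair)
  have "x > 2" "y > 2" "z > 2" using \<xi> by (auto simp: \<xi>_eq fricke_klein_def)
  then have "\<forall>\<^sub>F i in sequentially. p' i > 0 \<and> q' i > 0 \<and> r' i > 0 \<and>
      sqrt (p' i * q' i) > 2 \<and> sqrt (q' i * r' i) > 2 \<and> sqrt (p' i * r' i) > 2"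
    using param(5-7) p' q' r' sqrt by (auto intro!: eventually_conj order_tendstoD)
  then have "\<forall>\<^sub>F i in sequentially. \<xi>' i \<in> fricke_klein \<theta> \<and>
       (\<exists>n m. kernel_word n m \<in> kernel F2 PSL2R (holonomy (\<xi>' i)))"
  proof (rule eventually_mono)
    fix i
    assume i: "p' i > 0 \<and> q' i > 0 \<and> r' i > 0 \<and>
      sqrt (p' i * q' i) > 2 \<and> sqrt (q' i * r' i) > 2 \<and> sqrt (p' i * r' i) > 2"
    \<comment> \<open>The shift by one absorbs the summand \<sigma> of the third angle, which
      becomes -(N+m)\<sigma>; its sine is nonzero because m is positive, even if N = 0.\<close>
    obtain N where N: "n i = Suc N" using n(1)[of i] by (cases "n i") auto
    have neg: "\<sigma> - n i * \<sigma> - m i * \<sigma> = - (real (N + m i) * \<sigma>)" by (simp add: N algebra_simps)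
    have sin3: "sin (\<sigma> - n i * \<sigma> - m i * \<sigma>) \<noteq> 0"
      unfolding neg sin_minus using sin[of "N + m i"] m(1)[of i] by simp
    have rel: "p' i * q' i + q' i * r' i + p' i * r' i - p' i * q' i * r' i = 2 - 2 * cos (\<theta> / 2)"
      unfolding p'_def q'_def r'_def \<sigma>_def[symmetric]
      by (rule cot_par_relation[OF sin1 sin[OF n(1)] sin[OF m(1)] sin3])
    note fk = fricke_klein_param[OF rel]
    have mem: "\<xi>' i \<in> fricke_klein \<theta>" unfolding \<xi>'_def using fk(1) i by blast
    have "kernel_word N (m i) \<in> kernel F2 PSL2R (holonomy (\<xi>' i))"
      unfolding \<xi>'_def
    proof (rule kernel_word_in_kernel[OF mem[unfolded \<xi>'_def] \<sigma>_def])
      show "sin (real (Suc N) * \<sigma>) \<noteq> 0" "sin (real (m i) * \<sigma>) \<noteq> 0" "sin (real (N + m i) * \<sigma>) \<noteq> 0"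
        using m(1)[of i] by (intro sin; simp)+
      show "sqrt (p' i * q' i) * sqrt (p' i * r' i) / sqrt (q' i * r' i) = cot_par \<sigma> (real (Suc N) * \<sigma>)"
        using fk(2) i by (simp add: p'_def N)
      show "sqrt (p' i * q' i) * sqrt (q' i * r' i) / sqrt (p' i * r' i) = cot_par \<sigma> (real (m i) * \<sigma>)"
        using fk(3) i by (simp add: q'_def)
      show "sqrt (q' i * r' i) * sqrt (p' i * r' i) / sqrt (p' i * q' i) = cot_par \<sigma> (- (real (N + m i) * \<sigma>))"
        using fk(4) i unfolding r'_def neg by blast
    qed (rule sin1)
    with mem show "\<xi>' i \<in> fricke_klein \<theta> \<and> (\<exists>n m. kernel_word n m \<in> kernel F2 PSL2R (holonomy (\<xi>' i)))"
      by blast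
  qed
  with lim show thesis by (rule that)
qed

theorem theorem1p5:
  fixes \<theta> :: real
  assumes "0 < \<theta>" and "\<theta> < 2 * pi" and "\<theta> / pi \<notin> \<rat>"
  shows "\<exists>D. D \<subseteq> fricke_klein \<theta> \<and>
           top_of_set (fricke_klein \<theta>) closure_of D = fricke_klein \<theta> \<and>
           (\<forall>\<xi>\<in>D. \<exists>w \<in> kernel F2 PSL2R (holonomy \<xi>). palindromic w \<and> \<not> torsion_type w)"
proof -
  define D where "D = {\<xi> \<in> fricke_klein \<theta>. \<exists>n m. kernel_word n m \<in> kernel F2 PSL2R (holonomy \<xi>)}"
  have "fricke_klein \<theta> \<subseteq> closure D"
  proof
    fix \<xi> assume \<xi>: "\<xi> \<in> fricke_klein \<theta>"
    obtain \<xi>' where lim: "\<xi>' \<longlonglongrightarrow> \<xi>"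
      and ev: "\<forall>\<^sub>F i in sequentially. \<xi>' i \<in> fricke_klein \<theta> \<and>
         (\<exists>n m. kernel_word n m \<in> kernel F2 PSL2R (holonomy (\<xi>' i)))"
      by (rule fricke_klein_approximation[OF assms(3) \<xi>])
    \<comment> \<open>The approximants need to lie in \<open>D\<close> only from some index on,
      which suffices for a limit in a closed set.\<close>
    from ev have "\<forall>\<^sub>F i in sequentially. \<xi>' i \<in> closure D"
      by (rule eventually_mono) (use closure_subset[of D] in \<open>auto simp: D_def\<close>)
    then show "\<xi> \<in> closure D"
      using Lim_in_closed_set[OF closed_closure _ _ lim] by simp
  qed
  moreover have "D \<subseteq> fricke_klein \<theta>" by (auto simp: D_def)
  ultimately have "top_of_set (fricke_klein \<theta>) closure_of D = fricke_klein \<theta>"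
    by (auto simp: closure_of_subtopology Int_absorb1)
  moreover have "\<exists>w \<in> kernel F2 PSL2R (holonomy \<xi>). palindromic w \<and> \<not> torsion_type w" if "\<xi> \<in> D" for \<xi>
    using that palindromic_kernel_word not_torsion_type_kernel_word unfolding D_def by blast
  ultimately show ?thesis using \<open>D \<subseteq> fricke_klein \<theta>\<close> by blast
qed

end
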